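(* Let $\mathsf H$ be a separable Hilbert space, let $(\mu^i_n)_{n\in\mathbb N}$, $i=1,2$, be two sequences in $\mathcal P_2(\mathsf H)$ with $\boldsymbol\gamma_n\in\Gamma_o(\mu_n^1,\mu_n^2)$, and let $\mu^1,\mu^2\in\mathcal P_2(\mathsf H)$ with $\boldsymbol\gamma\in\Gamma(\mu^1,\mu^2)$. If $$(\mu^2_n)_{n\in\mathbb N}\text{ is tight in }\mathcal P(\mathsf H_w)\quad\text{and}\quad\boldsymbol\gamma_n\to\boldsymbol\gamma\text{ narrowly in }\mathcal P(\mathsf H_s\times\mathsf H_w)\text{ as }n\to\infty,$$ then $\mu^1_n\to\mu^1$ narrowly in $\mathcal P(\mathsf H)$, $\mu_n^2\to\mu^2$ narrowly in $\mathcal P(\mathsf H_w)$ and $\boldsymbol\gamma\in\Gamma_o(\mu^1,\mu^2)$. In particular, any limit point (i.e. limit of a subsequence) $\boldsymbol\gamma$ in $\mathcal P_{22}^{sw}(\mathsf H\times\mathsf H)$ of a sequence of optimal plans $\boldsymbol\gamma_n\in\Gamma_o(\mu_n^1,\mu_n^2)$ is optimal as well, i.e. it is an optimal plan between its marginals.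
   Context: $(\mathsf H,|\cdot|)$ is a separable Hilbert space; $\mathsf H_s$ and $\mathsf H_w$ denote $\mathsf H$ with its strong (norm) and weak topology respectively, and $\mathsf H_s\times\mathsf H_w$ carries the product topology (all these topologies have the same Borel sets as the corresponding strong ones). $\mathcal P_2(\mathsf H)$ is the set of Borel probability measures $\mu$ on $\mathsf H$ with $\int|x|^2\,\mathrm d\mu<\infty$. $\Gamma(\mu^1,\mu^2)$ is the set of Borel probability measures on $\mathsf H\times\mathsf H$ with marginals $\mu^1,\mu^2$; $\Gamma_o(\mu^1,\mu^2)\subset\Gamma(\mu^1,\mu^2)$ is the set of those minimizing $\int|x_1-x_2|^2\,\mathrm d\boldsymbol\gamma$ over $\Gamma(\mu^1,\mu^2)$ (optimal plans). Narrow convergence in $\mathcal P(X)$, $X$ a topological space, is convergence of $\int f\,\mathrm d\mu_n$ to $\int f\,\mathrm d\mu$ for every bounded continuous $f:X\to\mathbb R$. A set of measures is tight in $\mathcal P(X)$ if for every $\varepsilon>0$ there is a compact $K_\varepsilon\subset X$ such that $\mu(X\setminus K_\varepsilon)<\varepsilon$ for all $\mu$ in the set. $\mathcal P^{sw}_{22}(\mathsf H\times\mathsf H)$ is the set of Borel probability measures $\boldsymbol\mu$ on $\mathsf H\times\mathsf H$ with $\int(|x|^2+|y|^2)\,\mathrm d\boldsymbol\mu<\infty$, endowed with the coarsest topology making continuous all maps $\boldsymbol\mu\mapsto\int\zeta\,\mathrm d\boldsymbol\mu$, where $\zeta:\mathsf H\times\mathsf H\to\mathbb R$ ranges over the functions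 that are sequentially continuous on $\mathsf H_s\times\mathsf H_w$ and such that for every $\varepsilon>0$ there is $A_\varepsilon\ge0$ with $|\zeta(x,y)|\le A_\varepsilon(1+|x|^2)+\varepsilon|y|^2$ for all $(x,y)$. *)

theory Defs
  imports "HOL-Probability.Probability"
begin

text \<open>
  A separable Hilbert space is a type of sort \<open>{real_inner, polish_space}\<close>. The space
  \<open>H\<^sub>s\<close> is \<open>euclidean\<close>, which is the library's name for the topology of the type class, here the
  norm topology. All Borel probability measures are measures on the Borel sets of the norm topology.
\<close>

definition weak_topology :: "'a::real_normed_vector topology" where
  "weak_topology =
     topology_generated_by {f -` U | (f :: 'a \<Rightarrow> real) U. bounded_linear f \<and> open U}"

definition sw_topology :: "('a::real_normed_vector \<times> 'a) topology" where
  "sw_topology = prod_topology euclidean weak_topology"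

definition borel_prob :: "'a::topological_space measure set" where
  "borel_prob = {\<mu>. prob_space \<mu> \<and> sets \<mu> = sets borel}"

definition P2 :: "'a::real_normed_vector measure set" where
  "P2 = {\<mu> \<in> borel_prob. integrable \<mu> (\<lambda>x. (norm x)\<^sup>2)}"

definition couplings ::
  "'a::topological_space measure \<Rightarrow> 'a measure \<Rightarrow> ('a \<times> 'a) measure set" where
  "couplings \<mu>1 \<mu>2 =
     {\<gamma> \<in> borel_prob. distr \<gamma> borel fst = \<mu>1 \<and> distr \<gamma> borel snd = \<mu>2}"

definition quadratic_cost :: "('a::real_normed_vector \<times> 'a) measure \<Rightarrow> ennreal" where
  "quadratic_cost \<gamma> = (\<integral>\<^sup>+ (x, y). ennreal ((norm (x - y))\<^sup>2) \<partial>\<gamma>)"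

definition optimal_couplings ::
  "'a::real_normed_vector measure \<Rightarrow> 'a measure \<Rightarrow> ('a \<times> 'a) measure set" where
  "optimal_couplings \<mu>1 \<mu>2 =
     {\<gamma> \<in> couplings \<mu>1 \<mu>2. \<forall>\<gamma>' \<in> couplings \<mu>1 \<mu>2. quadratic_cost \<gamma> \<le> quadratic_cost \<gamma>'}"

definition narrowly_converges ::
  "'a topology \<Rightarrow> (nat \<Rightarrow> 'a measure) \<Rightarrow> 'a measure \<Rightarrow> bool" where
  "narrowly_converges X \<mu>s \<mu> \<longleftrightarrow>
     (\<forall>f :: 'a \<Rightarrow> real. continuous_map X euclideanreal f \<and> bounded (f ` topspace X) \<longrightarrow>
        (\<lambda>n. \<integral>x. f x \<partial>\<mu>s n) \<longlonglongrightarrow> (\<integral>x. f x \<partial>\<mu>))"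

text \<open>
  The definition below is only meaningful if compact sets are measurable, since \<open>measure\<close> is \<open>0\<close>
  on non-measurable sets. This is the case for \<open>weak_topology\<close>, which is Hausdorff and coarser than
  the norm topology.
\<close>

definition tight_in :: "'a topology \<Rightarrow> 'a measure set \<Rightarrow> bool" where
  "tight_in X M \<longleftrightarrow>
     (\<forall>\<epsilon>>0. \<exists>K. compactin X K \<and> (\<forall>\<mu>\<in>M. measure \<mu> (topspace X - K) < \<epsilon>))"

definition seq_continuous :: "'a topology \<Rightarrow> ('a \<Rightarrow> real) \<Rightarrow> bool" where
  "seq_continuous X f \<longleftrightarrow>
     (\<forall>zs z. limitin X zs z sequentially \<longrightarrow> (\<lambda>n. f (zs n)) \<longlonglongrightarrow> f z)"

definition sw_test_functions :: "('a::real_normed_vector \<times> 'a \<Rightarrow> real) set" where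
  "sw_test_functions =
     {\<zeta>. seq_continuous sw_topology \<zeta> \<and>
         (\<forall>\<epsilon>>0. \<exists>A\<ge>0. \<forall>x y. \<bar>\<zeta> (x, y)\<bar> \<le> A * (1 + (norm x)\<^sup>2) + \<epsilon> * (norm y)\<^sup>2)}"

definition P22 :: "('a::real_normed_vector \<times> 'a) measure set" where
  "P22 = {\<mu> \<in> borel_prob. integrable \<mu> (\<lambda>(x, y). (norm x)\<^sup>2 + (norm y)\<^sup>2)}"

definition P22_sw :: "('a::real_normed_vector \<times> 'a) measure topology" where
  "P22_sw =
     topology_generated_by
       {{\<mu> \<in> P22. (\<integral>z. \<zeta> z \<partial>\<mu>) \<in> U} | \<zeta> U. \<zeta> \<in> sw_test_functions \<and> open U}"

end

theory Submission imports Defs begin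

text \<open>
  Optimality of a plan amounts to maximality of the integral of the inner product. If \<open>\<gamma>\<close> is
  optimal, then almost every sample of \<open>N\<close> independent pairs drawn from \<open>\<gamma>\<close> satisfies the cyclic
  monotonicity inequality, since otherwise shifting the first components on the bad event would
  produce a better plan. Cyclic monotonicity survives the strong-weak limit because tightness of the
  second marginals confines all but \<open>\<epsilon>\<close> of the mass to bounded second components, where the inner
  product is continuous. Rockafellar's potential of the resulting cyclically monotone set of full
  measure, together with its conjugate, then certifies that the limit plan is optimal. For limits
  with respect to the test functions of quadratic growth, the required uniform tail estimate is
  obtained by a gliding hump argument.
\<close>

section \<open>The weak topology\<close>

text \<open>The cost itself does not pass to the limit: no uniform bound on second moments is
  assumed, and the inner product is unbounded and in general not jointly continuous for the
  strong-weak topology. Optimality is therefore carried through an inequality about finitely many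
  points, while finite second moments are used for each measure separately, to make the inner
  product integrable. Both halves of the theorem reduce to one estimate: up to \<epsilon>, all
  second marginals live in a common ball. In the first half the ball comes from weak compactness by
  Banach-Steinhaus, which is where completeness enters. In the second half no tightness is given and
  |y|^2 is not an admissible test function, since a test function must be dominated by
  \<epsilon>|y|^2 for every \<epsilon>. What helps is that test functions need only be sequentially
  continuous: an infinite sum of bumps escaping to infinity qualifies, because a weakly convergent
  sequence is bounded and meets finitely many of them.\<close>

lemma topspace_weak_topology [simp]: "topspace weak_topology = (UNIV :: 'a::real_normed_vector set)"
proof -
  have "(UNIV :: 'a set) = (\<lambda>_. 0) -` (UNIV :: real set)" by simp
  then have "(UNIV :: 'a set) \<in> {f -` U | (f :: 'a \<Rightarrow> real) U. bounded_linear f \<and> open U}"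
    using bounded_linear_zero open_UNIV by blast
  then show ?thesis
    unfolding weak_topology_def topology_generated_by_topspace by blast
qed

lemma topspace_sw_topology [simp]: "topspace sw_topology = (UNIV :: ('a::real_normed_vector \<times> 'a) set)"
  by (simp add: sw_topology_def)

lemma continuous_map_weak_topology_linear:
  assumes "bounded_linear (f :: 'a::real_normed_vector \<Rightarrow> real)"
  shows "continuous_map weak_topology euclideanreal f"
  unfolding continuous_map_alt topspace_weak_topology
  using assms by (auto simp: weak_topology_def intro!: topology_generated_by_Basis)

lemma continuous_map_into_weak_topology:
  "continuous_map euclidean (weak_topology :: 'a::real_normed_vector topology) id"
  unfolding weak_topology_def
proof (rule continuous_on_generated_topo)
  show "openin euclidean (id -` V \<inter> topspace euclidean)"
    if "V \<in> {f -` U | (f :: 'a \<Rightarrow> real) U. bounded_linear f \<and> open U}" for V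
    using that by (auto intro!: open_vimage linear_continuous_on simp: bounded_linear.linear)
next
  show "id ` topspace euclidean \<subseteq> \<Union> {f -` U | (f :: 'a \<Rightarrow> real) U. bounded_linear f \<and> open U}"
    using topspace_weak_topology unfolding weak_topology_def topology_generated_by_topspace by auto
qed

text \<open>Through this, weakly continuous functions are Borel for the norm topology, so one
  sigma-algebra serves both topologies.\<close>

lemma continuous_on_if_weak:
  assumes "continuous_map weak_topology euclidean (f :: 'a::real_normed_vector \<Rightarrow> 'b::topological_space)"
  shows "continuous_on UNIV f"
  using continuous_map_compose[OF continuous_map_into_weak_topology assms] by simp

lemma continuous_on_if_sw:
  assumes "continuous_map sw_topology euclidean
    (f :: 'a::real_normed_vector \<times> 'a \<Rightarrow> 'b::topological_space)"
  shows "continuous_on UNIV f"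
proof -
  have "continuous_map (prod_topology euclidean euclidean) sw_topology (id :: 'a \<times> 'a \<Rightarrow> _)"
    unfolding sw_topology_def continuous_map_pairwise
    using continuous_map_fst[of euclidean euclidean]
      continuous_map_compose[OF continuous_map_snd[of euclidean euclidean]
        continuous_map_into_weak_topology]
    by (simp add: o_def)
  from continuous_map_compose[OF this assms] show ?thesis by simp
qed

lemma Hausdorff_weak_topology: "Hausdorff_space (weak_topology :: 'a::real_inner topology)"
  unfolding Hausdorff_space_def
proof (intro allI impI, elim conjE)
  fix x y :: 'a assume "x \<noteq> y"
  define f where "f = inner (x - y)"
  have f: "continuous_map weak_topology euclideanreal f"
    unfolding f_def by (intro continuous_map_weak_topology_linear bounded_linear_inner_right)
  have "f x - f y > 0"
    using \<open>x \<noteq> y\<close> by (simp add: f_def flip: inner_diff_right)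
  then obtain U V where "open U" "open V" "f x \<in> U" "f y \<in> V" "U \<inter> V = {}"
    using separation_t2[of "f x" "f y"] by auto
  then show "\<exists>U V. openin weak_topology U \<and> openin weak_topology V \<and> x \<in> U \<and> y \<in> V \<and> disjnt U V"
    using f by (intro exI[of _ "f -` U"] exI[of _ "f -` V"])
      (auto simp: continuous_map_alt disjnt_def)
qed

text \<open>Makes complements of weakly compact sets Borel, so that \<open>measure\<close> in
  \<open>tight_in\<close> is not its default value 0.\<close>

lemma weakly_compact_closed:
  assumes "compactin weak_topology (K :: 'a::real_inner set)"
  shows "closed K"
proof -
  have "closedin weak_topology K"
    by (rule compactin_imp_closedin[OF Hausdorff_weak_topology assms])
  from closedin_continuous_map_preimage[OF continuous_map_into_weak_topology this] show ?thesis
    by simp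
qed

text \<open>Banach-Steinhaus by Baire: the closed sets \<open>F m\<close> of vectors whose pairing
  with every point of \<open>K\<close> is at most \<open>m\<close> cover the space, so one of them
  contains a ball.\<close>

lemma weakly_bounded_imp_bounded:
  fixes K :: "'a::{real_inner, complete_space} set"
  assumes bdd: "\<And>a. bounded (inner a ` K)"
  shows "bounded K"
proof -
  define F where "F m = (\<Inter>y\<in>K. {a. \<bar>inner a y\<bar> \<le> real m})" for m :: nat
  have cl: "closed (F m)" for m
    unfolding F_def by (intro closed_INT ballI closed_Collect_le continuous_intros)
  have cover: "(\<Union>m. F m) = UNIV"
  proof -
    have "a \<in> (\<Union>m. F m)" for a
    proof -
      obtain B where B: "\<And>y. y \<in> K \<Longrightarrow> \<bar>inner a y\<bar> \<le> B"
        using bdd[of a] by (auto simp: bounded_iff)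
      obtain m where "B \<le> real m" using real_arch_simple by blast
      then have "a \<in> F m" using B by (auto simp: F_def intro: order_trans[of _ B])
      then show ?thesis by blast
    qed
    then show ?thesis by auto
  qed
  have "\<exists>m. interior (F m) \<noteq> {}"
  proof (rule ccontr)
    assume none: "\<nexists>m. interior (F m) \<noteq> {}"
    have "euclidean interior_of \<Union>(range F) = {}"
    proof (rule Baire_category_alt)
      fix T assume "T \<in> range F"
      then show "closedin euclidean T \<and> euclidean interior_of T = {}"
        using none cl by (auto simp: interior_of_def interior_def)
    qed (auto simp: completely_metrizable_space_euclidean)
    moreover have "euclidean interior_of (UNIV :: 'a set) = UNIV"
      using interior_of_topspace[of euclidean] by simp
    ultimately show False using cover by simp
  qed
  then obtain m a where "a \<in> interior (F m)" by blast
  then obtain r where "r > 0" and r: "cball a r \<subseteq> F m"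
    by (meson interior_subset open_contains_cball open_interior order_trans)
  have "norm y \<le> 2 * real m / r" if "y \<in> K" for y
  proof (cases "y = 0")
    case False
    define v where "v = (r / norm y) *\<^sub>R y"
    have "norm v = r" using False \<open>r > 0\<close> by (simp add: v_def)
    \<comment> \<open>\<open>v\<close> is \<open>y\<close> rescaled to length \<open>r\<close>, so
      \<open>a\<close> and \<open>a + v\<close> both lie in the ball; subtracting their pairings
      with \<open>y\<close> leaves \<open>r * norm y\<close>.\<close>
    then have "a + v \<in> F m" "a \<in> F m" using r \<open>r > 0\<close> by (auto simp: subset_eq dist_norm)
    then have "\<bar>inner (a + v) y\<bar> \<le> m" "\<bar>inner a y\<bar> \<le> m" using that by (auto simp: F_def)
    moreover have "inner v y = r * norm y"
      using False by (simp add: v_def dot_square_norm power2_eq_square)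
    ultimately have "r * norm y \<le> 2 * real m" by (simp add: inner_add_left)
    then show ?thesis using \<open>r > 0\<close> by (simp add: field_simps)
  qed (use \<open>r > 0\<close> in auto)
  then show ?thesis by (auto simp: bounded_iff)
qed

lemma weakly_compact_bounded:
  assumes "compactin weak_topology (K :: 'a::{real_inner, complete_space} set)"
  shows "bounded K"
proof (rule weakly_bounded_imp_bounded)
  fix a :: 'a
  have "compactin euclideanreal (inner a ` K)"
    using assms by (intro image_compactin[where X = weak_topology]
        continuous_map_weak_topology_linear bounded_linear_inner_right)
  then show "bounded (inner a ` K)" by (simp add: compact_imp_bounded)
qed

lemma weakly_convergent_inner:
  assumes "limitin weak_topology ys y F"
  shows "((\<lambda>n. inner a (ys n)) \<longlongrightarrow> inner a (y :: 'a::real_inner)) F"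
  using continuous_map_limit[OF continuous_map_weak_topology_linear[OF bounded_linear_inner_right] assms]
  by (simp add: o_def)

text \<open>Special to sequences: a weakly convergent net may be unbounded. The sequential
  continuity of the hump function below rests on this.\<close>

lemma weakly_convergent_bounded:
  assumes "limitin weak_topology ys (y :: 'a::{real_inner, complete_space}) sequentially"
  shows "bounded (range ys)"
proof (rule weakly_bounded_imp_bounded)
  fix a :: 'a
  show "bounded (inner a ` range ys)"
    using convergent_imp_bounded[OF weakly_convergent_inner[OF assms, of a]] by (simp add: image_image)
qed

text \<open>
  A cluster point, in the compact space of all truth assignments to predicates, of the sequence of
  evaluations \<open>P \<mapsto> P n\<close> decides every predicate.
\<close>

lemma ultrafilter_on_sequence:
  obtains F :: "nat filter"
  where "F \<noteq> bot" "F \<le> sequentially" "\<And>P. eventually P F \<or> eventually (\<lambda>n. \<not> P n) F"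
proof -
  define f where "f n P = P n" for n and P :: "nat \<Rightarrow> bool"
  have "compact_space (product_topology (\<lambda>_::nat \<Rightarrow> bool. euclidean :: bool topology) UNIV)"
    by (simp add: compact_space_product_topology) (simp add: compact_space_def finite_imp_compact)
  then have "compact (UNIV :: ((nat \<Rightarrow> bool) \<Rightarrow> bool) set)"
    by (simp add: euclidean_product_topology compact_space_def)
  then obtain x where x: "inf (nhds x) (filtermap f sequentially) \<noteq> bot"
    unfolding compact_filter
    using filtermap_bot_iff[of f sequentially] trivial_limit_sequentially by auto
  \<comment> \<open>\<open>x P\<close> is the limiting truth value of \<open>P\<close>. Pulling back
    the neighbourhoods of \<open>x\<close> selects the indices where finitely many predicates
    already have their limiting value.\<close>
  define F where "F = inf sequentially (filtercomap f (nhds x))"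
  have dec: "eventually (\<lambda>n. P n = x P) F" for P
  proof -
    have "open {h :: (nat \<Rightarrow> bool) \<Rightarrow> bool. h P = x P}"
      using open_vimage[OF Topological_Spaces.open_discrete[of "{x P}"] continuous_on_product_coordinates[of P]]
      by (simp add: vimage_def)
    then have "eventually (\<lambda>h. h P = x P) (nhds x)"
      using eventually_nhds_in_open[of "{h. h P = x P}" x] by simp
    then have "eventually (\<lambda>n. P n = x P) (filtercomap f (nhds x))"
      unfolding eventually_filtercomap by (auto simp: f_def intro!: exI[of _ "\<lambda>h. h P = x P"])
    then show ?thesis unfolding F_def by (rule filter_leD[OF inf_le2])
  qed
  show thesis
  proof
    show "F \<noteq> bot"
    proof
      assume "F = bot"
      then obtain P Q where P: "eventually P sequentially" and Q: "eventually Q (nhds x)"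
        and PQ: "\<And>n. P n \<Longrightarrow> Q (f n) \<Longrightarrow> False"
        unfolding F_def trivial_limit_def eventually_inf eventually_filtercomap by fast
      have "eventually (\<lambda>n. \<not> Q (f n)) sequentially"
        using PQ by (intro eventually_mono[OF P]) auto
      then have "eventually (\<lambda>h. \<not> Q h) (filtermap f sequentially)"
        by (simp add: eventually_filtermap)
      with Q have "eventually (\<lambda>_. False) (inf (nhds x) (filtermap f sequentially))"
        unfolding eventually_inf by blast
      with x show False by (simp add: trivial_limit_def)
    qed
    show "F \<le> sequentially" by (simp add: F_def)
    show "eventually P F \<or> eventually (\<lambda>n. \<not> P n) F" for P
      using dec[of P] by (cases "x P") auto
  qed
qed

section \<open>Couplings and cyclic sums\<close>

lemma couplingsD:
  assumes "\<gamma> \<in> couplings \<mu>1 \<mu>2"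
  shows "prob_space \<gamma>" "sets \<gamma> = sets borel" "space \<gamma> = UNIV"
    "distr \<gamma> borel fst = \<mu>1" "distr \<gamma> borel snd = \<mu>2"
  using assms sets_eq_imp_space_eq[of \<gamma> borel] by (auto simp: couplings_def borel_prob_def)

lemma measurable_fst_snd_borel [measurable]:
  "fst \<in> borel_measurable (borel :: ('a::topological_space \<times> 'b::topological_space) measure)"
  "snd \<in> borel_measurable (borel :: ('a \<times> 'b) measure)"
  by (intro borel_measurable_continuous_onI continuous_intros)+

lemma abs_inner_le_sum_squares: "\<bar>inner x y\<bar> \<le> (norm x)\<^sup>2 + (norm (y :: 'a::real_inner))\<^sup>2"
proof -
  have "\<bar>inner x y\<bar> \<le> norm x * norm y" by (rule Cauchy_Schwarz_ineq2)
  also have "\<dots> \<le> (norm x)\<^sup>2 + (norm y)\<^sup>2"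
  proof -
    have "2 * (norm x * norm y) \<le> (norm x)\<^sup>2 + (norm y)\<^sup>2"
      using sum_squares_bound[of "norm x" "norm y"] by (simp add: mult.assoc)
    moreover have "0 \<le> norm x * norm y" by simp
    ultimately show ?thesis by linarith
  qed
  finally show ?thesis .
qed

lemma coupling_integrable:
  fixes \<mu>1 \<mu>2 :: "'a::{real_inner, polish_space} measure"
  assumes "\<gamma> \<in> couplings \<mu>1 \<mu>2" "\<mu>1 \<in> P2" "\<mu>2 \<in> P2"
  shows "integrable \<gamma> (\<lambda>z. (norm (fst z))\<^sup>2)" "integrable \<gamma> (\<lambda>z. (norm (snd z))\<^sup>2)"
    "integrable \<gamma> (\<lambda>z. inner (fst z) (snd z))"
    "integrable \<gamma> (\<lambda>z. inner a (fst z))" "integrable \<gamma> (\<lambda>z. inner a (snd z))"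
proof -
  note [measurable_cong] = couplingsD(2)[OF assms(1)]
  interpret prob_space \<gamma> by (rule couplingsD(1)[OF assms(1)])
  show 1: "integrable \<gamma> (\<lambda>z. (norm (fst z))\<^sup>2)"
    using assms(2) unfolding couplingsD(4)[OF assms(1), symmetric] P2_def
    by (simp add: integrable_distr_eq)
  show 2: "integrable \<gamma> (\<lambda>z. (norm (snd z))\<^sup>2)"
    using assms(3) unfolding couplingsD(5)[OF assms(1), symmetric] P2_def
    by (simp add: integrable_distr_eq)
  show "integrable \<gamma> (\<lambda>z. inner (fst z) (snd z))"
    by (rule Bochner_Integration.integrable_bound[OF Bochner_Integration.integrable_add[OF 1 2]])
       (auto simp: abs_inner_le_sum_squares)
  have c: "integrable \<gamma> (\<lambda>_. (norm a)\<^sup>2)" by simp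
  show "integrable \<gamma> (\<lambda>z. inner a (fst z))"
    by (rule Bochner_Integration.integrable_bound[OF Bochner_Integration.integrable_add[OF c 1]])
       (auto simp: abs_inner_le_sum_squares)
  show "integrable \<gamma> (\<lambda>z. inner a (snd z))"
    by (rule Bochner_Integration.integrable_bound[OF Bochner_Integration.integrable_add[OF c 2]])
       (auto simp: abs_inner_le_sum_squares)
qed

text \<open>Expanding the square leaves only the inner product term depending on the plan.
  Nonnegativity is recorded because \<open>ennreal\<close> truncates at 0, so comparing costs as
  reals requires it.\<close>

lemma quadratic_cost_eq:
  fixes \<mu>1 \<mu>2 :: "'a::{real_inner, polish_space} measure"
  assumes "\<gamma> \<in> couplings \<mu>1 \<mu>2" "\<mu>1 \<in> P2" "\<mu>2 \<in> P2"
  shows "quadratic_cost \<gamma> =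
    ennreal ((\<integral>x. (norm x)\<^sup>2 \<partial>\<mu>1) + (\<integral>y. (norm y)\<^sup>2 \<partial>\<mu>2) - 2 * (\<integral>z. inner (fst z) (snd z) \<partial>\<gamma>))"
    and "0 \<le> (\<integral>x. (norm x)\<^sup>2 \<partial>\<mu>1) + (\<integral>y. (norm y)\<^sup>2 \<partial>\<mu>2) - 2 * (\<integral>z. inner (fst z) (snd z) \<partial>\<gamma>)"
proof -
  note [measurable_cong] = couplingsD(2)[OF assms(1)]
  note int = coupling_integrable[OF assms]
  have eq: "(norm (fst z - snd z))\<^sup>2 = (norm (fst z))\<^sup>2 + (norm (snd z))\<^sup>2 - 2 * inner (fst z) (snd z)"
    for z :: "'a \<times> 'a"
    by (simp add: power2_norm_eq_inner inner_diff_left inner_diff_right inner_commute)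
  have I: "integrable \<gamma> (\<lambda>z. (norm (fst z - snd z))\<^sup>2)"
    unfolding eq using int by simp
  have "(\<integral>x. (norm x)\<^sup>2 \<partial>\<mu>1) = (\<integral>z. (norm (fst z))\<^sup>2 \<partial>\<gamma>)"
    "(\<integral>x. (norm x)\<^sup>2 \<partial>\<mu>2) = (\<integral>z. (norm (snd z))\<^sup>2 \<partial>\<gamma>)"
    unfolding couplingsD(4,5)[OF assms(1), symmetric] by (simp_all add: integral_distr)
  then have *: "(\<integral>z. (norm (fst z - snd z))\<^sup>2 \<partial>\<gamma>) =
    (\<integral>x. (norm x)\<^sup>2 \<partial>\<mu>1) + (\<integral>y. (norm y)\<^sup>2 \<partial>\<mu>2) - 2 * (\<integral>z. inner (fst z) (snd z) \<partial>\<gamma>)"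
    unfolding eq using int by simp
  show "quadratic_cost \<gamma> =
    ennreal ((\<integral>x. (norm x)\<^sup>2 \<partial>\<mu>1) + (\<integral>y. (norm y)\<^sup>2 \<partial>\<mu>2) - 2 * (\<integral>z. inner (fst z) (snd z) \<partial>\<gamma>))"
    unfolding quadratic_cost_def *[symmetric] case_prod_beta
    using I by (intro nn_integral_eq_integral) auto
  show "0 \<le> (\<integral>x. (norm x)\<^sup>2 \<partial>\<mu>1) + (\<integral>y. (norm y)\<^sup>2 \<partial>\<mu>2) - 2 * (\<integral>z. inner (fst z) (snd z) \<partial>\<gamma>)"
    unfolding *[symmetric] by simp
qed

lemma optimal_couplings_iff:
  fixes \<mu>1 \<mu>2 :: "'a::{real_inner, polish_space} measure"
  assumes "\<mu>1 \<in> P2" "\<mu>2 \<in> P2"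
  shows "\<gamma> \<in> optimal_couplings \<mu>1 \<mu>2 \<longleftrightarrow> \<gamma> \<in> couplings \<mu>1 \<mu>2 \<and>
    (\<forall>\<gamma>'\<in>couplings \<mu>1 \<mu>2. (\<integral>z. inner (fst z) (snd z) \<partial>\<gamma>') \<le> (\<integral>z. inner (fst z) (snd z) \<partial>\<gamma>))"
proof -
  have "quadratic_cost \<gamma> \<le> quadratic_cost \<gamma>' \<longleftrightarrow>
      (\<integral>z. inner (fst z) (snd z) \<partial>\<gamma>') \<le> (\<integral>z. inner (fst z) (snd z) \<partial>\<gamma>)"
    if "\<gamma> \<in> couplings \<mu>1 \<mu>2" "\<gamma>' \<in> couplings \<mu>1 \<mu>2" for \<gamma>'
    using quadratic_cost_eq[OF that(1) assms] quadratic_cost_eq[OF that(2) assms] by simp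
  then show ?thesis unfolding optimal_couplings_def by blast
qed

text \<open>The gain when each first component is replaced by its successor in the cycle; the
  \<open>mod\<close> closes the cycle.\<close>

definition cyclic_sum :: "nat \<Rightarrow> (nat \<Rightarrow> 'a::real_inner \<times> 'a) \<Rightarrow> real" where
  "cyclic_sum N z = (\<Sum>i<N. inner (fst (z (Suc i mod N)) - fst (z i)) (snd (z i)))"

lemma bij_betw_add_mod:
  assumes "0 < N"
  shows "bij_betw (\<lambda>i. (i + k) mod N) {..<N} {..<N::nat}"
proof -
  have "j \<in> (\<lambda>i. (i + k) mod N) ` {..<N}" if "j < N" for j
  proof (rule image_eqI)
    \<comment> \<open>Adding the multiple \<open>N * k\<close> keeps the subtraction of
      \<open>k\<close> from truncating at 0.\<close>
    have "k \<le> j + N * k" using assms by (cases N) auto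
    then have "j + N * k - k + k = j + N * k" by (rule le_add_diff_inverse2)
    then show "j = ((j + N * k - k) mod N + k) mod N"
      using that by (simp only: mod_add_left_eq) simp
  qed (use assms in auto)
  then have "{..<N} \<subseteq> (\<lambda>i. (i + k) mod N) ` {..<N}" by blast
  moreover have "(\<lambda>i. (i + k) mod N) ` {..<N} \<subseteq> {..<N}"
    using assms by (intro image_subsetI) simp
  ultimately have *: "(\<lambda>i. (i + k) mod N) ` {..<N} = {..<N}" by (rule subset_antisym[rotated])
  have "inj_on (\<lambda>i. (i + k) mod N) {..<N}"
    by (rule eq_card_imp_inj_on) (simp_all only: * finite_lessThan)
  with * show ?thesis unfolding bij_betw_def by simp
qed

text \<open>Rotation only reindexes the sum. The shifted tuple is restricted to
  \<open>{..<N}\<close> because points of \<open>Pi\<^sub>M\<close> are extensional.\<close>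

lemma cyclic_sum_shift:
  assumes "0 < N"
  shows "cyclic_sum N (\<lambda>i\<in>{..<N}. z ((i + k) mod N)) = cyclic_sum N z"
proof -
  have "cyclic_sum N (\<lambda>i\<in>{..<N}. z ((i + k) mod N)) =
    (\<Sum>i<N. inner (fst (z (Suc ((i + k) mod N) mod N)) - fst (z ((i + k) mod N))) (snd (z ((i + k) mod N))))"
    unfolding cyclic_sum_def by (intro sum.cong refl) (simp add: mod_simps)
  also have "\<dots> = cyclic_sum N z"
    unfolding cyclic_sum_def by (rule sum.reindex_bij_betw[OF bij_betw_add_mod[OF assms]])
  finally show ?thesis .
qed

lemma cyclic_sum_measurable [measurable]:
  assumes [measurable_cong]: "sets \<gamma> = sets (borel :: ('a::{real_inner, polish_space} \<times> 'a) measure)"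
  shows "cyclic_sum N \<in> borel_measurable (Pi\<^sub>M {..<N} (\<lambda>_. \<gamma>))"
  unfolding cyclic_sum_def by measurable

lemma coupling_measurable:
  assumes "\<gamma> \<in> couplings \<mu>1 \<mu>2"
  shows "fst \<in> \<gamma> \<rightarrow>\<^sub>M borel" "snd \<in> \<gamma> \<rightarrow>\<^sub>M borel"
  using measurable_fst_snd_borel by (simp_all cong: measurable_cong_sets add: couplingsD(2)[OF assms])

lemma coupling_in_P22:
  fixes \<mu>1 \<mu>2 :: "'a::{real_inner, polish_space} measure"
  assumes "\<gamma> \<in> couplings \<mu>1 \<mu>2" "\<mu>1 \<in> P2" "\<mu>2 \<in> P2"
  shows "\<gamma> \<in> P22"
  using assms(1) coupling_integrable(1,2)[OF assms]
  unfolding P22_def couplings_def case_prod_beta by simp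

lemma P22_marginals:
  assumes "(\<gamma> :: ('a::{real_inner, polish_space} \<times> 'a) measure) \<in> P22"
  shows "\<gamma> \<in> couplings (distr \<gamma> borel fst) (distr \<gamma> borel snd)"
    "distr \<gamma> borel fst \<in> P2" "distr \<gamma> borel snd \<in> P2"
proof -
  show cpl: "\<gamma> \<in> couplings (distr \<gamma> borel fst) (distr \<gamma> borel snd)"
    using assms by (simp add: couplings_def P22_def)
  note [measurable_cong] = couplingsD(2)[OF cpl] and [measurable] = coupling_measurable[OF cpl]
  interpret prob_space \<gamma> by (rule couplingsD(1)[OF cpl])
  have int: "integrable \<gamma> (\<lambda>z. (norm (fst z))\<^sup>2 + (norm (snd z))\<^sup>2)"
    using assms unfolding P22_def case_prod_beta by simp
  have "integrable \<gamma> (\<lambda>z. (norm (fst z))\<^sup>2)" "integrable \<gamma> (\<lambda>z. (norm (snd z))\<^sup>2)"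
    by (rule Bochner_Integration.integrable_bound[OF int]; simp)+
  then show "distr \<gamma> borel fst \<in> P2" "distr \<gamma> borel snd \<in> P2"
    by (simp_all add: P2_def borel_prob_def prob_space_distr integrable_distr_eq)
qed

text \<open>
  Draw \<open>N\<close> independent pairs from \<open>\<gamma>\<close>. The event that shifting the first components
  cyclically increases the sum of inner products is invariant under the shift, so replacing
  \<open>x\<^sub>0\<close> by \<open>x\<^sub>1\<close> on this event leaves the law of the first component unchanged and gives
  a competitor of \<open>\<gamma>\<close>.
\<close>

lemma optimal_coupling_cyclic_sum_nonpos:
  fixes \<mu>1 \<mu>2 :: "'a::{real_inner, polish_space} measure"
  assumes opt: "\<gamma> \<in> optimal_couplings \<mu>1 \<mu>2" and "\<mu>1 \<in> P2" "\<mu>2 \<in> P2"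
  shows "AE w in Pi\<^sub>M {..<N} (\<lambda>_. \<gamma>). cyclic_sum N w \<le> 0"
proof (cases "N = 0")
  case True
  then show ?thesis by (simp add: cyclic_sum_def)
next
  case False
  then have "0 < N" by simp
  have cpl: "\<gamma> \<in> couplings \<mu>1 \<mu>2" using opt by (simp add: optimal_couplings_def)
  note [measurable_cong] = couplingsD(2)[OF cpl]
  define P where "P = Pi\<^sub>M {..<N} (\<lambda>_. \<gamma>)"
  define c where "c = (cyclic_sum N :: (nat \<Rightarrow> 'a \<times> 'a) \<Rightarrow> real)"
  define shift where "shift k w = (\<lambda>i\<in>{..<N}. w ((i + k) mod N))" for k and w :: "nat \<Rightarrow> 'a \<times> 'a"
  interpret \<gamma>: prob_space \<gamma> by (rule couplingsD(1)[OF cpl])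
  interpret P: prob_space P unfolding P_def by (intro prob_space_PiM \<gamma>.prob_space_axioms)
  have c_meas [measurable]: "c \<in> borel_measurable P"
    unfolding c_def P_def by (rule cyclic_sum_measurable[OF couplingsD(2)[OF cpl]])
  have comp_meas [measurable]: "(\<lambda>w. w i) \<in> P \<rightarrow>\<^sub>M borel" if "i < N" for i
    using measurable_component_singleton[of i "{..<N}" "\<lambda>_. \<gamma>"] that unfolding P_def by simp
  have [measurable]: "(\<lambda>w. w 0) \<in> P \<rightarrow>\<^sub>M borel" "(\<lambda>w. w (Suc i mod N)) \<in> P \<rightarrow>\<^sub>M borel" for i
    using \<open>0 < N\<close> by (auto intro!: comp_meas)
  have shift_meas [measurable]: "shift k \<in> P \<rightarrow>\<^sub>M P" for k
    unfolding shift_def P_def using \<open>0 < N\<close> by (intro measurable_restrict measurable_component_singleton) auto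
  \<comment> \<open>Independent, identically distributed coordinates may be permuted without
    changing the joint law.\<close>
  have shift_P: "distr P P (shift k) = P" for k
    using distr_PiM_reindex[of "{..<N}" "\<lambda>_. \<gamma>" "\<lambda>i. (i + k) mod N" "{..<N}"]
      bij_betw_add_mod[OF \<open>0 < N\<close>, of k] \<gamma>.prob_space_axioms \<open>0 < N\<close>
    unfolding P_def shift_def by (auto simp: bij_betw_def)
  have comp_P: "distr P borel (\<lambda>w. w i) = \<gamma>" if "i < N" for i
    using distr_PiM_component[of "{..<N}" "\<lambda>_. \<gamma>" i] \<gamma>.prob_space_axioms that
    unfolding P_def by (simp cong: distr_cong add: couplingsD(2)[OF cpl])
  have c_shift: "c (shift k w) = c w" for k w
    unfolding c_def shift_def by (rule cyclic_sum_shift[OF \<open>0 < N\<close>])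
  have shift_0: "shift k w 0 = w (k mod N)" for k w
    using \<open>0 < N\<close> by (simp add: shift_def)
  have shift_1: "shift k w (Suc 0 mod N) = w (Suc k mod N)" for k w
    using \<open>0 < N\<close> by (simp add: shift_def mod_simps)

  note fst_meas = coupling_measurable(1)[OF cpl]
  \<comment> \<open>The competitor is the law of \<open>T\<close>. With \<open>Suc 0 mod N\<close>
    in place of 1, the case \<open>N = 1\<close> refers to the existing coordinate 0.\<close>
  define T where "T w = (if 0 < c w then (fst (w (Suc 0 mod N)), snd (w 0)) else w 0)" for w
  have T_meas [measurable]: "T \<in> P \<rightarrow>\<^sub>M borel"
    unfolding T_def by (intro measurable_If borel_measurable_Pair) measurable
  define \<gamma>' where "\<gamma>' = distr P borel T"

  have "distr \<gamma>' borel fst = distr P borel (\<lambda>w. fst (T w))"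
    unfolding \<gamma>'_def by (simp add: distr_distr o_def)
  also have "\<dots> = \<mu>1"
  proof (rule measure_eqI)
    show "sets (distr P borel (\<lambda>w. fst (T w))) = sets \<mu>1" using \<open>\<mu>1 \<in> P2\<close> by (simp add: P2_def borel_prob_def)
    fix B assume "B \<in> sets (distr P borel (\<lambda>w. fst (T w)))"
    then have [measurable]: "B \<in> sets borel" by simp
    have "emeasure (distr P borel (\<lambda>w. fst (T w))) B =
        (\<integral>\<^sup>+ w. indicator B (fst (T w)) \<partial>P)"
      by (simp add: nn_integral_distr flip: nn_integral_indicator)
    also have "\<dots> = (\<integral>\<^sup>+ w. indicator {w. 0 < c w} w * indicator B (fst (w (Suc 0 mod N))) +
        indicator {w. \<not> 0 < c w} w * indicator B (fst (w 0)) \<partial>P)"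
      by (intro nn_integral_cong) (simp add: T_def indicator_def)
    also have "\<dots> = (\<integral>\<^sup>+ w. indicator {w. 0 < c w} w * indicator B (fst (w (Suc 0 mod N))) \<partial>P) +
        (\<integral>\<^sup>+ w. indicator {w. \<not> 0 < c w} w * indicator B (fst (w 0)) \<partial>P)"
      by (intro nn_integral_add) measurable
    \<comment> \<open>On the event, the first component at position 1 is the one at position 0 after
      the shift, and both \<open>P\<close> and the event are shift invariant.\<close>
    also have "(\<integral>\<^sup>+ w. indicator {w. 0 < c w} w * indicator B (fst (w (Suc 0 mod N))) \<partial>P) =
        (\<integral>\<^sup>+ w. indicator {w. 0 < c w} w * indicator B (fst (w 0)) \<partial>distr P P (shift 1))"
      by (subst nn_integral_distr) (simp_all add: c_shift shift_0 indicator_def)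
    also have "\<dots> = (\<integral>\<^sup>+ w. indicator {w. 0 < c w} w * indicator B (fst (w 0)) \<partial>P)"
      by (simp only: shift_P)
    also have "\<dots> + (\<integral>\<^sup>+ w. indicator {w. \<not> 0 < c w} w * indicator B (fst (w 0)) \<partial>P) =
        (\<integral>\<^sup>+ w. indicator {w. 0 < c w} w * indicator B (fst (w 0)) +
          indicator {w. \<not> 0 < c w} w * indicator B (fst (w 0)) \<partial>P)"
      by (intro nn_integral_add[symmetric]) measurable
    also have "\<dots> = (\<integral>\<^sup>+ w. indicator B (fst (w 0)) \<partial>P)"
      by (intro nn_integral_cong) (simp add: indicator_def)
    also have "\<dots> = (\<integral>\<^sup>+ z. indicator B (fst z) \<partial>distr P borel (\<lambda>w. w 0))"
      by (simp add: nn_integral_distr)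
    also have "\<dots> = (\<integral>\<^sup>+ z. indicator B (fst z) \<partial>\<gamma>)" by (simp only: comp_P[OF \<open>0 < N\<close>])
    also have "\<dots> = (\<integral>\<^sup>+ x. indicator B x \<partial>distr \<gamma> borel fst)"
      by (subst nn_integral_distr[OF fst_meas]) auto
    also have "\<dots> = emeasure (distr \<gamma> borel fst) B" by simp
    finally show "emeasure (distr P borel (\<lambda>w. fst (T w))) B = emeasure \<mu>1 B"
      by (simp add: couplingsD(4)[OF cpl])
  qed
  finally have marg1: "distr \<gamma>' borel fst = \<mu>1" .
  have "distr \<gamma>' borel snd = distr P borel (snd \<circ> (\<lambda>w. w 0))"
  proof -
    have "snd \<circ> T = snd \<circ> (\<lambda>w. w 0)" by (auto simp: T_def)
    then show ?thesis unfolding \<gamma>'_def by (simp add: distr_distr)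
  qed
  also have "\<dots> = distr (distr P borel (\<lambda>w. w 0)) borel snd"
    by (simp add: distr_distr)
  also have "\<dots> = \<mu>2"
    by (simp add: comp_P[OF \<open>0 < N\<close>] couplingsD(5)[OF cpl])
  finally have marg2: "distr \<gamma>' borel snd = \<mu>2" .
  have "prob_space \<gamma>'" unfolding \<gamma>'_def by (rule P.prob_space_distr) measurable
  then have cpl': "\<gamma>' \<in> couplings \<mu>1 \<mu>2"
    by (simp add: couplings_def borel_prob_def marg1 marg2) (simp add: \<gamma>'_def)

  \<comment> \<open>\<open>h i\<close> is the gain at position \<open>i\<close> on the event. Its
    integral does not depend on \<open>i\<close> by shift invariance, and for \<open>i = 0\<close>
    it is the gain of the competitor over \<gamma>, hence nonpositive. Since the \<open>h i\<close>
    add up to the positive part of \<open>c\<close>, that part vanishes almost everywhere.\<close>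
  define h where "h i w = (if 0 < c w then inner (fst (w (Suc i mod N)) - fst (w i)) (snd (w i)) else 0)" for i w
  have int: "integrable P (\<lambda>w. inner (fst (w i)) (snd (w j)))" if "i < N" "j < N" for i j
  proof (rule Bochner_Integration.integrable_bound)
    have "integrable (distr P borel (\<lambda>w. w i)) (\<lambda>z. (norm (fst z))\<^sup>2)"
      "integrable (distr P borel (\<lambda>w. w j)) (\<lambda>z. (norm (snd z))\<^sup>2)"
      unfolding comp_P[OF that(1)] comp_P[OF that(2)]
      using coupling_integrable[OF cpl assms(2,3)] by auto
    then show "integrable P (\<lambda>w. (norm (fst (w i)))\<^sup>2 + (norm (snd (w j)))\<^sup>2)"
      using comp_meas[OF that(1)] comp_meas[OF that(2)]
      by (intro Bochner_Integration.integrable_add) (simp_all add: integrable_distr_eq)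
    show "(\<lambda>w. inner (fst (w i)) (snd (w j))) \<in> borel_measurable P"
      using comp_meas[OF that(1)] comp_meas[OF that(2)] by measurable
  qed (auto simp: abs_inner_le_sum_squares)
  have int_diff: "integrable P (\<lambda>w. inner (fst (w (Suc i mod N)) - fst (w i)) (snd (w i)))" if "i < N" for i
    unfolding inner_diff_left using that \<open>0 < N\<close> by (intro Bochner_Integration.integrable_diff int) auto
  have int_h: "integrable P (h i)" if "i < N" for i
  proof (rule Bochner_Integration.integrable_bound[OF int_diff[OF that]])
    show "h i \<in> borel_measurable P" unfolding h_def using comp_meas[OF that] by measurable
  qed (auto simp: h_def)
  have h_shift: "(\<integral>w. h i w \<partial>P) = (\<integral>w. h 0 w \<partial>P)" if "i < N" for i
  proof -
    have "(\<integral>w. h 0 w \<partial>P) = (\<integral>w. h 0 w \<partial>distr P P (shift i))" by (simp only: shift_P)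
    also have "\<dots> = (\<integral>w. h 0 (shift i w) \<partial>P)"
      using int_h[OF \<open>0 < N\<close>] by (intro integral_distr) auto
    also have "\<dots> = (\<integral>w. h i w \<partial>P)" by (simp only: h_def c_shift shift_0 shift_1 mod_less[OF that])
    finally show ?thesis by simp
  qed
  have "(\<integral>w. h 0 w \<partial>P) = (\<integral>w. inner (fst (T w)) (snd (T w)) - inner (fst (w 0)) (snd (w 0)) \<partial>P)"
    by (intro Bochner_Integration.integral_cong) (auto simp: h_def T_def inner_diff_left)
  also have "\<dots> = (\<integral>w. inner (fst (T w)) (snd (T w)) \<partial>P) - (\<integral>w. inner (fst (w 0)) (snd (w 0)) \<partial>P)"
  proof (rule Bochner_Integration.integral_diff)
    have "integrable \<gamma>' (\<lambda>z. inner (fst z) (snd z))"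
      by (rule coupling_integrable(3)[OF cpl' assms(2,3)])
    then show "integrable P (\<lambda>w. inner (fst (T w)) (snd (T w)))"
      unfolding \<gamma>'_def by (simp add: integrable_distr_eq)
  qed (intro int \<open>0 < N\<close>)
  also have "(\<integral>w. inner (fst (T w)) (snd (T w)) \<partial>P) = (\<integral>z. inner (fst z) (snd z) \<partial>\<gamma>')"
    unfolding \<gamma>'_def by (simp add: integral_distr)
  also have "(\<integral>w. inner (fst (w 0)) (snd (w 0)) \<partial>P) = (\<integral>z. inner (fst z) (snd z) \<partial>distr P borel (\<lambda>w. w 0))"
    by (simp add: integral_distr)
  also have "\<dots> = (\<integral>z. inner (fst z) (snd z) \<partial>\<gamma>)" by (simp only: comp_P[OF \<open>0 < N\<close>])
  finally have h0: "(\<integral>w. h 0 w \<partial>P) \<le> 0"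
    using opt cpl' unfolding optimal_couplings_iff[OF assms(2,3)] by auto

  have h_sum: "(\<Sum>i<N. h i w) = max 0 (c w)" for w
  proof (cases "0 < c w")
    case True
    then have "(\<Sum>i<N. h i w) = c w" by (simp add: h_def) (simp add: c_def cyclic_sum_def)
    with True show ?thesis by simp
  qed (simp add: h_def)
  have int_c: "integrable P (\<lambda>w. max 0 (c w))"
    unfolding h_sum[symmetric] by (intro Bochner_Integration.integrable_sum int_h) simp
  have "(\<integral>w. max 0 (c w) \<partial>P) = (\<Sum>i<N. \<integral>w. h i w \<partial>P)"
    unfolding h_sum[symmetric] by (intro Bochner_Integration.integral_sum int_h) simp
  also have "\<dots> = (\<Sum>i<N. \<integral>w. h 0 w \<partial>P)" by (intro sum.cong h_shift) auto
  also have "\<dots> \<le> 0" using h0 by (intro sum_nonpos) auto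
  finally have "(\<integral>w. max 0 (c w) \<partial>P) = 0"
    by (intro order.antisym Bochner_Integration.integral_nonneg) auto
  then have "AE w in P. max 0 (c w) = 0"
    using int_c by (subst (asm) integral_nonneg_eq_0_iff_AE) auto
  then have "AE w in P. c w \<le> 0" by eventually_elim simp
  then show ?thesis unfolding P_def c_def .
qed

section \<open>Cyclic monotonicity and Rockafellar potentials\<close>

definition cyclically_monotone :: "('a::real_inner \<times> 'a) set \<Rightarrow> bool" where
  "cyclically_monotone L \<longleftrightarrow> (\<forall>N z. (\<forall>i<N. z i \<in> L) \<longrightarrow> cyclic_sum N z \<le> 0)"

text \<open>
  A pair \<open>(p, b)\<close> encodes the affine function \<open>x \<mapsto> \<langle>x, p\<rangle> + b\<close>. The functions generated here are those
  in Rockafellar's construction of a convex potential whose subdifferential contains \<open>L\<close>.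
\<close>

inductive_set affine_minorants :: "('a::real_inner \<times> 'a) set \<Rightarrow> 'a \<times> 'a \<Rightarrow> ('a \<times> real) set"
  for L z0 where
    base: "(snd z0, - inner (fst z0) (snd z0)) \<in> affine_minorants L z0"
  | step: "(p, b) \<in> affine_minorants L z0 \<Longrightarrow> z \<in> L \<Longrightarrow>
      (snd z, inner (fst z) p + b - inner (fst z) (snd z)) \<in> affine_minorants L z0"

text \<open>Unrolling the induction recovers Rockafellar's telescoping sum. The chain must be
  explicit because cyclic monotonicity speaks about whole cycles, not single steps.\<close>

lemma affine_minorant_chain:
  assumes "(p, b) \<in> affine_minorants L z0" "z0 \<in> L"
  shows "\<exists>k z. (\<forall>i\<le>k. z i \<in> L) \<and> z 0 = z0 \<and>
    (\<forall>x. inner x p + b =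
      inner (x - fst (z k)) (snd (z k)) + (\<Sum>i<k. inner (fst (z (Suc i)) - fst (z i)) (snd (z i))))"
  using assms
proof induction
  case base
  then show ?case
    by (intro exI[of _ 0] exI[of _ "\<lambda>_. z0"]) (simp add: inner_diff_left)
next
  case (step p b y)
  from step.IH[OF step.prems] obtain k z where z: "\<forall>i\<le>k. z i \<in> L" "z 0 = z0" and
    eq: "\<forall>x. inner x p + b =
      inner (x - fst (z k)) (snd (z k)) + (\<Sum>i<k. inner (fst (z (Suc i)) - fst (z i)) (snd (z i)))"
    by blast
  let ?z = "z(Suc k := y)"
  have "(\<Sum>i<k. inner (fst (?z (Suc i)) - fst (?z i)) (snd (?z i))) =
      (\<Sum>i<k. inner (fst (z (Suc i)) - fst (z i)) (snd (z i)))"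
    by (intro sum.cong) auto
  then have "inner x (snd y) + (inner (fst y) p + b - inner (fst y) (snd y)) =
      inner (x - fst (?z (Suc k))) (snd (?z (Suc k))) +
      (\<Sum>i<Suc k. inner (fst (?z (Suc i)) - fst (?z i)) (snd (?z i)))" for x
    using eq[THEN spec, of "fst y"] by (simp add: inner_diff_left)
  moreover have "\<forall>i\<le>Suc k. ?z i \<in> L" "?z 0 = z0" using z step.hyps by auto
  ultimately show ?case by blast
qed

text \<open>Evaluating at the starting point closes the chain \<open>z 0, ..., z k\<close> into a
  cycle of length \<open>Suc k\<close>.\<close>

lemma affine_minorant_nonpos:
  assumes L: "cyclically_monotone L" and "(p, b) \<in> affine_minorants L z0" "z0 \<in> L"
  shows "inner (fst z0) p + b \<le> 0"
proof -
  obtain k z where z: "\<forall>i\<le>k. z i \<in> L" "z 0 = z0" and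
    eq: "\<forall>x. inner x p + b =
      inner (x - fst (z k)) (snd (z k)) + (\<Sum>i<k. inner (fst (z (Suc i)) - fst (z i)) (snd (z i)))"
    using affine_minorant_chain[OF assms(2,3)] by blast
  have "(\<Sum>i<k. inner (fst (z (Suc i mod Suc k)) - fst (z i)) (snd (z i))) =
      (\<Sum>i<k. inner (fst (z (Suc i)) - fst (z i)) (snd (z i)))"
    by (intro sum.cong) auto
  then have "inner (fst z0) p + b = cyclic_sum (Suc k) z"
    unfolding eq[THEN spec] cyclic_sum_def using z(2) by simp
  also have "\<dots> \<le> 0"
    using L z(1) unfolding cyclically_monotone_def by (auto simp: less_Suc_eq_le)
  finally show ?thesis .
qed

section \<open>Rockafellar's potential: measurability, subgradients, finiteness\<close>

definition potential :: "('a::real_inner \<times> 'a) set \<Rightarrow> 'a \<times> 'a \<Rightarrow> 'a \<Rightarrow> ereal" where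
  "potential L z0 x = (SUP q\<in>affine_minorants L z0. ereal (inner x (fst q) + snd q))"

text \<open>The supremum may be uncountable, but as a supremum of continuous functions it is lower
  semicontinuous: its superlevel sets are open.\<close>

lemma potential_measurable [measurable]: "potential L z0 \<in> borel_measurable borel"
proof (rule borel_measurableI_greater)
  fix y
  have "{x \<in> space borel. y < potential L z0 x} =
      (\<Union>q\<in>affine_minorants L z0. {x. y < ereal (inner x (fst q) + snd q)})"
    unfolding potential_def less_SUP_iff by auto
  also have "open \<dots>"
    by (intro open_UN ballI) (auto intro!: open_Collect_less continuous_intros)
  finally show "{x \<in> space borel. y < potential L z0 x} \<in> sets borel" by simp
qed

lemma potential_lower_bound: "ereal (inner (x - fst z0) (snd z0)) \<le> potential L z0 x"
  unfolding potential_def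
  by (rule SUP_upper2[OF affine_minorants.base]) (simp add: inner_diff_left)

text \<open>Extending any minorant by \<open>z\<close> through the rule \<open>step\<close> gives a
  minorant again, with slope \<open>snd z\<close> and the old value at \<open>fst z\<close>.\<close>

lemma potential_subgradient:
  assumes "z \<in> L"
  shows "potential L z0 (fst z) + ereal (inner (x - fst z) (snd z)) \<le> potential L z0 x"
proof -
  have "ereal (inner (fst z) p + b) \<le> potential L z0 x - ereal (inner (x - fst z) (snd z))"
    if "(p, b) \<in> affine_minorants L z0" for p b
  proof -
    have "ereal (inner (fst z) p + b + inner (x - fst z) (snd z)) \<le> potential L z0 x"
      unfolding potential_def
      by (rule SUP_upper2[OF affine_minorants.step[OF that assms]]) (simp add: inner_diff_left)
    then show ?thesis by (cases "potential L z0 x") auto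
  qed
  then have "potential L z0 (fst z) \<le> potential L z0 x - ereal (inner (x - fst z) (snd z))"
    unfolding potential_def[of L z0 "fst z"] by (intro SUP_least) auto
  then show ?thesis by (cases "potential L z0 x"; cases "potential L z0 (fst z)") auto
qed

text \<open>Cyclic monotonicity bounds the potential at \<open>fst z0\<close> by 0; the subgradient
  inequality at \<open>z\<close>, tested at \<open>fst z0\<close>, carries this upper bound over to
  \<open>fst z\<close>.\<close>

lemma potential_finite:
  assumes "cyclically_monotone L" "z0 \<in> L" "z \<in> L"
  shows "\<bar>potential L z0 (fst z)\<bar> \<noteq> \<infinity>"
proof -
  have "potential L z0 (fst z0) \<le> 0"
    unfolding potential_def using affine_minorant_nonpos[OF assms(1) _ assms(2)]
    by (intro SUP_least) auto
  with potential_subgradient[OF assms(3), of z0 "fst z0"] potential_lower_bound[of "fst z" z0 L]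
  show ?thesis by (cases "potential L z0 (fst z)"; cases "potential L z0 (fst z0)") auto
qed


text \<open>A Kantorovich dual certificate: the inner product is at most \<open>f x + g y\<close> on
  the domains of the two potentials, with equality on \<open>L\<close>, and the integral of
  \<open>f x + g y\<close> is the same for all couplings.\<close>

lemma cyclically_monotone_imp_optimal:
  fixes \<mu>1 \<mu>2 :: "'a::{real_inner, polish_space} measure"
  assumes cpl: "\<gamma> \<in> couplings \<mu>1 \<mu>2" and P2: "\<mu>1 \<in> P2" "\<mu>2 \<in> P2"
    and L: "cyclically_monotone L" and AE_L: "AE z in \<gamma>. z \<in> L"
  shows "\<gamma> \<in> optimal_couplings \<mu>1 \<mu>2"
proof -
  interpret prob_space \<gamma> by (rule couplingsD(1)[OF cpl])
  have "L \<noteq> {}" using AE_L AE_False by auto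
  then obtain z0 where z0: "z0 \<in> L" by blast
  define \<phi> where "\<phi> = potential L z0"
  \<comment> \<open>The supremum leaves out points where \<phi> is infinite, since
    \<open>real_of_ereal\<close> would turn that value into 0.\<close>
  define \<psi> where "\<psi> y = (SUP x\<in>{x. \<phi> x < \<infinity>}. ereal (inner x y - real_of_ereal (\<phi> x)))" for y
  define f where "f x = real_of_ereal (\<phi> x)" for x
  define g where "g y = real_of_ereal (\<psi> y)" for y
  have [measurable]: "\<phi> \<in> borel_measurable borel" unfolding \<phi>_def by measurable
  have [measurable]: "\<psi> \<in> borel_measurable borel"
  proof (rule borel_measurableI_greater)
    fix t
    have "{y \<in> space borel. t < \<psi> y} =
        (\<Union>x\<in>{x. \<phi> x < \<infinity>}. {y. t < ereal (inner x y - real_of_ereal (\<phi> x))})"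
      unfolding \<psi>_def less_SUP_iff by auto
    also have "open \<dots>"
      by (intro open_UN ballI open_Collect_less continuous_intros)
    finally show "{y \<in> space borel. t < \<psi> y} \<in> sets borel" by simp
  qed
  have fg_meas [measurable]: "f \<in> borel_measurable borel" "g \<in> borel_measurable borel"
    unfolding f_def g_def by measurable
  have \<phi>_lower: "ereal (inner (x - fst z0) (snd z0)) \<le> \<phi> x" for x
    unfolding \<phi>_def by (rule potential_lower_bound)
  have \<phi>_f: "\<phi> x = ereal (f x)" if "\<phi> x < \<infinity>" for x
    using that \<phi>_lower[of x] by (cases "\<phi> x") (auto simp: f_def)
  have \<phi>_L: "\<phi> (fst z) = ereal (f (fst z))" if "z \<in> L" for z
    using potential_finite[OF L z0 that] by (intro \<phi>_f) (auto simp: \<phi>_def)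
  have \<psi>_L: "\<psi> (snd z) = ereal (inner (fst z) (snd z) - f (fst z))" if "z \<in> L" for z
  proof (rule antisym)
    have "inner x (snd z) - f x \<le> inner (fst z) (snd z) - f (fst z)" if "\<phi> x < \<infinity>" for x
      using potential_subgradient[OF \<open>z \<in> L\<close>, of z0 x]
      unfolding \<phi>_def[symmetric] \<phi>_L[OF \<open>z \<in> L\<close>] \<phi>_f[OF that] by (simp add: inner_diff_left)
    then show "\<psi> (snd z) \<le> ereal (inner (fst z) (snd z) - f (fst z))"
      unfolding \<psi>_def f_def[symmetric] by (intro SUP_least) simp
    show "ereal (inner (fst z) (snd z) - f (fst z)) \<le> \<psi> (snd z)"
      unfolding \<psi>_def f_def[symmetric] by (intro SUP_upper) (simp add: \<phi>_L[OF that])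
  qed
  have young: "inner x y \<le> f x + g y" if "\<phi> x < \<infinity>" "\<psi> y < \<infinity>" for x y
  proof -
    have "ereal (inner x y - f x) \<le> \<psi> y"
      unfolding \<psi>_def f_def[symmetric] using that by (intro SUP_upper) simp
    then show ?thesis using that by (cases "\<psi> y") (auto simp: g_def)
  qed
  have eq: "inner (fst z) (snd z) = f (fst z) + g (snd z)" if "z \<in> L" for z
    using \<psi>_L[OF that] by (simp add: g_def)

  note fst_meas = coupling_measurable(1) and snd_meas = coupling_measurable(2)
  note int = coupling_integrable[OF cpl P2]
  have int_f: "integrable \<gamma> (\<lambda>z. f (fst z))"
  proof (rule Bochner_Integration.integrable_bound)
    \<comment> \<open>From below, \<open>f\<close> is bounded by the first affine minorant. From
      above, on \<open>L\<close> it equals the inner product minus \<open>g\<close>, and the Young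
      inequality with \<open>fst z0\<close> bounds \<open>g\<close> from below.\<close>
    let ?b = "\<lambda>z. \<bar>inner (fst z) (snd z)\<bar> + \<bar>inner (fst z0) (snd z)\<bar> + \<bar>inner (snd z0) (fst z)\<bar> +
      (\<bar>f (fst z0)\<bar> + \<bar>inner (fst z0) (snd z0)\<bar>)"
    show "integrable \<gamma> ?b" using int by (intro Bochner_Integration.integrable_add integrable_abs) auto
    show "(\<lambda>z. f (fst z)) \<in> borel_measurable \<gamma>"
      by (rule measurable_compose[OF fst_meas[OF cpl] fg_meas(1)])
    show "AE z in \<gamma>. norm (f (fst z)) \<le> norm (?b z)"
      using AE_L
    proof eventually_elim
      case (elim z)
      have "inner (snd z0) (fst z) - inner (fst z0) (snd z0) \<le> f (fst z)"
        using \<phi>_lower[of "fst z"] \<phi>_L[OF elim] by (simp add: inner_diff_right inner_commute)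
      moreover have "inner (fst z0) (snd z) \<le> f (fst z0) + g (snd z)"
        using \<phi>_L[OF z0] \<psi>_L[OF elim] by (intro young) auto
      ultimately have "\<bar>f (fst z)\<bar> \<le> ?b z"
        using eq[OF elim] by linarith
      then show ?case by (simp only: real_norm_def) linarith
    qed
  qed
  have int_g: "integrable \<gamma> (\<lambda>z. g (snd z))"
  proof (rule Bochner_Integration.integrable_cong_AE_imp)
    show "integrable \<gamma> (\<lambda>z. inner (fst z) (snd z) - f (fst z))" using int int_f by simp
    show "(\<lambda>z. g (snd z)) \<in> borel_measurable \<gamma>"
      by (rule measurable_compose[OF snd_meas[OF cpl] fg_meas(2)])
    show "AE z in \<gamma>. inner (fst z) (snd z) - f (fst z) = g (snd z)"
      using AE_L by eventually_elim (simp add: eq)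
  qed
  have "(\<integral>z. inner (fst z) (snd z) \<partial>\<gamma>) = (\<integral>z. f (fst z) + g (snd z) \<partial>\<gamma>)"
  proof (rule integral_cong_AE)
    show "AE z in \<gamma>. inner (fst z) (snd z) = f (fst z) + g (snd z)"
      using AE_L by eventually_elim (rule eq)
  qed (intro borel_measurable_integrable int Bochner_Integration.integrable_add int_f int_g)+
  also have "\<dots> = (\<integral>z. f (fst z) \<partial>\<gamma>) + (\<integral>z. g (snd z) \<partial>\<gamma>)"
    using int_f int_g by (rule Bochner_Integration.integral_add)
  also have "(\<integral>z. f (fst z) \<partial>\<gamma>) = (\<integral>x. f x \<partial>\<mu>1)"
    unfolding couplingsD(4)[OF cpl, symmetric] by (rule integral_distr[OF fst_meas[OF cpl] fg_meas(1), symmetric])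
  also have "(\<integral>z. g (snd z) \<partial>\<gamma>) = (\<integral>y. g y \<partial>\<mu>2)"
    unfolding couplingsD(5)[OF cpl, symmetric] by (rule integral_distr[OF snd_meas[OF cpl] fg_meas(2), symmetric])
  finally have \<gamma>_eq: "(\<integral>z. inner (fst z) (snd z) \<partial>\<gamma>) = (\<integral>x. f x \<partial>\<mu>1) + (\<integral>y. g y \<partial>\<mu>2)" .

  have f1: "integrable \<mu>1 f" and g2: "integrable \<mu>2 g"
    using int_f int_g unfolding couplingsD(4,5)[OF cpl, symmetric]
    by (simp_all add: integrable_distr_eq[OF fst_meas[OF cpl] fg_meas(1)]
        integrable_distr_eq[OF snd_meas[OF cpl] fg_meas(2)])
  have AE1: "AE x in \<mu>1. \<phi> x < \<infinity>"
    unfolding couplingsD(4)[OF cpl, symmetric]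
  proof (subst AE_distr_iff[OF fst_meas[OF cpl]])
    show "AE z in \<gamma>. \<phi> (fst z) < \<infinity>" using AE_L by eventually_elim (simp add: \<phi>_L)
  qed measurable
  have AE2: "AE y in \<mu>2. \<psi> y < \<infinity>"
    unfolding couplingsD(5)[OF cpl, symmetric]
  proof (subst AE_distr_iff[OF snd_meas[OF cpl]])
    show "AE z in \<gamma>. \<psi> (snd z) < \<infinity>" using AE_L by eventually_elim (simp add: \<psi>_L)
  qed measurable

  \<comment> \<open>The domains of the potentials have full measure for the marginals, hence for
    every coupling, so the Young inequality holds almost everywhere for the competitor.\<close>
  have "(\<integral>z. inner (fst z) (snd z) \<partial>\<eta>) \<le> (\<integral>z. inner (fst z) (snd z) \<partial>\<gamma>)"
    if \<eta>: "\<eta> \<in> couplings \<mu>1 \<mu>2" for \<eta>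
  proof -
    note fst_meas = fst_meas[OF \<eta>] and snd_meas = snd_meas[OF \<eta>]
    have intf: "integrable \<eta> (\<lambda>z. f (fst z))" and intg: "integrable \<eta> (\<lambda>z. g (snd z))"
      using f1 g2 unfolding couplingsD(4,5)[OF \<eta>, symmetric]
      by (simp_all add: integrable_distr_eq[OF fst_meas fg_meas(1)]
          integrable_distr_eq[OF snd_meas fg_meas(2)])
    have "AE z in \<eta>. \<phi> (fst z) < \<infinity>"
      using AE1 unfolding couplingsD(4)[OF \<eta>, symmetric] by (rule AE_distrD[OF fst_meas])
    moreover have "AE z in \<eta>. \<psi> (snd z) < \<infinity>"
      using AE2 unfolding couplingsD(5)[OF \<eta>, symmetric] by (rule AE_distrD[OF snd_meas])
    ultimately have "AE z in \<eta>. inner (fst z) (snd z) \<le> f (fst z) + g (snd z)"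
      by eventually_elim (rule young)
    then have "(\<integral>z. inner (fst z) (snd z) \<partial>\<eta>) \<le> (\<integral>z. f (fst z) + g (snd z) \<partial>\<eta>)"
      using coupling_integrable(3)[OF \<eta> P2] intf intg
      by (intro integral_mono_AE Bochner_Integration.integrable_add)
    also have "\<dots> = (\<integral>z. f (fst z) \<partial>\<eta>) + (\<integral>z. g (snd z) \<partial>\<eta>)"
      using intf intg by (rule Bochner_Integration.integral_add)
    also have "(\<integral>z. f (fst z) \<partial>\<eta>) = (\<integral>x. f x \<partial>\<mu>1)"
      unfolding couplingsD(4)[OF \<eta>, symmetric] by (rule integral_distr[OF fst_meas fg_meas(1), symmetric])
    also have "(\<integral>z. g (snd z) \<partial>\<eta>) = (\<integral>y. g y \<partial>\<mu>2)"
      unfolding couplingsD(5)[OF \<eta>, symmetric] by (rule integral_distr[OF snd_meas fg_meas(2), symmetric])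
    finally show ?thesis by (simp add: \<gamma>_eq)
  qed
  with cpl show ?thesis unfolding optimal_couplings_iff[OF P2] by blast
qed

section \<open>Stability under strong-weak limits\<close>

text \<open>
  The inner product is continuous for the strong-weak topology only along bounded second
  components. The supports of the \<open>\<gamma>s n\<close> therefore have to be cut off at a fixed radius \<open>R\<close>
  before passing to the limit; a neighbourhood of a point in the support of the limit measure may
  have so little mass that its intersections with the cut off supports are empty. Taking the limit
  along an ultrafilter makes finitely many points of the limit approximable by the same \<open>\<gamma>s n\<close>.
\<close>

definition negligible_functions :: "nat filter \<Rightarrow> (nat \<Rightarrow> ('a::real_normed_vector \<times> 'a) measure) \<Rightarrow> real \<Rightarrow>
    ('a \<times> 'a \<Rightarrow> real) set" where
  "negligible_functions F \<gamma>s R = {g. continuous_map sw_topology euclideanreal g \<and> (\<forall>z. 0 \<le> g z) \<and>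
     (\<forall>\<^sub>F n in F. AE z in \<gamma>s n. norm (snd z) \<le> R \<longrightarrow> g z = 0)}"

text \<open>Encoded by continuous functions instead of neighbourhoods, so that narrow convergence
  applies directly to what is removed.\<close>

definition limit_support :: "nat filter \<Rightarrow> (nat \<Rightarrow> ('a::real_normed_vector \<times> 'a) measure) \<Rightarrow> real \<Rightarrow>
    ('a \<times> 'a) set" where
  "limit_support F \<gamma>s R = {z. \<forall>g\<in>negligible_functions F \<gamma>s R. g z = 0}"

lemma limit_support_mono:
  assumes "R \<le> R'"
  shows "limit_support F \<gamma>s R \<subseteq> limit_support F \<gamma>s R'"
proof -
  have "negligible_functions F \<gamma>s R' \<subseteq> negligible_functions F \<gamma>s R"
    unfolding negligible_functions_def
  proof (safe)
    fix g assume "\<forall>\<^sub>F n in F. AE z in \<gamma>s n. norm (snd z) \<le> R' \<longrightarrow> g z = 0"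
    then show "\<forall>\<^sub>F n in F. AE z in \<gamma>s n. norm (snd z) \<le> R \<longrightarrow> g z = 0"
    proof eventually_elim
      case (elim n)
      then show ?case by eventually_elim (use assms in simp)
    qed
  qed
  then show ?thesis unfolding limit_support_def by blast
qed

lemma negligible_functions_sum:
  fixes m :: nat
  assumes "\<And>k. k < m \<Longrightarrow> g k \<in> negligible_functions F \<gamma>s R"
  shows "(\<lambda>z. \<Sum>k<m. g k z) \<in> negligible_functions F \<gamma>s R"
proof -
  have "\<forall>\<^sub>F n in F. \<forall>k\<in>{..<m}. AE z in \<gamma>s n. norm (snd z) \<le> R \<longrightarrow> g k z = 0"
    using assms by (intro eventually_ball_finite) (auto simp: negligible_functions_def)
  then have "\<forall>\<^sub>F n in F. AE z in \<gamma>s n. norm (snd z) \<le> R \<longrightarrow> (\<Sum>k<m. g k z) = 0"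
  proof eventually_elim
    case (elim n)
    then have "AE z in \<gamma>s n. \<forall>k\<in>{..<m}. norm (snd z) \<le> R \<longrightarrow> g k z = 0"
      by (intro AE_finite_allI) auto
    then show ?case by eventually_elim simp
  qed
  moreover have "continuous_map sw_topology euclideanreal (\<lambda>z. \<Sum>k<m. g k z)"
    using assms by (intro continuous_map_sum) (auto simp: negligible_functions_def)
  ultimately show ?thesis
    using assms by (auto simp: negligible_functions_def intro!: sum_nonneg)
qed

lemma Compl_limit_support:
  "- limit_support F \<gamma>s R = (\<Union>g\<in>negligible_functions F \<gamma>s R. {z. 0 < g z})"
  unfolding limit_support_def negligible_functions_def by (auto simp: less_le)

lemma open_positive_sw:
  assumes "continuous_map sw_topology euclideanreal g"
  shows "open {z. 0 < g z}"
  using continuous_on_if_sw[OF assms] by (intro open_Collect_less continuous_on_const) auto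

lemma open_Compl_limit_support: "open (- limit_support F \<gamma>s R)"
  unfolding Compl_limit_support
  by (intro open_UN ballI open_positive_sw) (simp add: negligible_functions_def)

locale narrow_limit =
  fixes \<gamma>s :: "nat \<Rightarrow> ('a::{real_inner, polish_space} \<times> 'a) measure" and \<gamma> and F :: "nat filter"
  assumes \<gamma>s: "\<And>n. \<gamma>s n \<in> borel_prob" and \<gamma>: "\<gamma> \<in> borel_prob"
    and narrow: "narrowly_converges sw_topology \<gamma>s \<gamma>"
    and F: "F \<noteq> bot" "F \<le> sequentially"
begin

lemma prob_space_\<gamma>s: "prob_space (\<gamma>s n)" and sets_\<gamma>s [measurable_cong]: "sets (\<gamma>s n) = sets borel"
  and prob_space_\<gamma>: "prob_space \<gamma>" and sets_\<gamma> [measurable_cong]: "sets \<gamma> = sets borel"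
  using \<gamma>s[of n] \<gamma> by (auto simp: borel_prob_def)

lemma space_\<gamma>s: "space (\<gamma>s n) = UNIV" and space_\<gamma>: "space \<gamma> = UNIV"
  using sets_eq_imp_space_eq[OF sets_\<gamma>s[of n]] sets_eq_imp_space_eq[OF sets_\<gamma>] by auto

text \<open>The portmanteau inequality for the open set \<open>{z. 0 < g z}\<close>: for the
  measures of the sequence this set lies, eventually along \<open>F\<close> and up to null sets, in
  the tail beyond radius \<open>R\<close>.\<close>

lemma measure_negligible_function:
  assumes g: "g \<in> negligible_functions F \<gamma>s R"
    and tail: "\<And>n. measure (\<gamma>s n) {z. R < norm (snd z)} \<le> \<epsilon>"
  shows "measure \<gamma> {z. 0 < g z} \<le> \<epsilon>"
proof -
  interpret \<gamma>: prob_space \<gamma> by (rule prob_space_\<gamma>)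
  have cont: "continuous_map sw_topology euclideanreal g" and nn: "\<And>z. 0 \<le> g z"
    using g by (auto simp: negligible_functions_def)
  have [measurable]: "g \<in> borel_measurable borel"
    using continuous_on_if_sw[OF cont] by (rule borel_measurable_continuous_onI)
  \<comment> \<open>Bounded continuous functions increasing with \<open>j\<close> to the indicator
    of \<open>{z. 0 < g z}\<close>.\<close>
  define f where "f j z = min 1 (real j * g z)" for j z
  have [measurable]: "f j \<in> borel_measurable borel" for j unfolding f_def by measurable
  have f_bound: "0 \<le> f j z" "f j z \<le> 1" for j z using nn[of z] by (auto simp: f_def)
  have f_le: "(\<integral>z. f j z \<partial>\<gamma>) \<le> \<epsilon>" for j
  proof (rule tendsto_upperbound)
    have "continuous_map sw_topology euclideanreal (f j)"
      unfolding f_def using cont by (intro continuous_map_real_min continuous_map_real_mult) auto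
    moreover have "bounded (f j ` topspace sw_topology)"
      unfolding bounded_iff using f_bound by (intro exI[of _ 1]) (auto simp: abs_le_iff intro: order_trans[of _ 0])
    ultimately have "(\<lambda>n. \<integral>z. f j z \<partial>\<gamma>s n) \<longlonglongrightarrow> (\<integral>z. f j z \<partial>\<gamma>)"
      using narrow by (simp add: narrowly_converges_def)
    then show "((\<lambda>n. \<integral>z. f j z \<partial>\<gamma>s n) \<longlongrightarrow> (\<integral>z. f j z \<partial>\<gamma>)) F"
      by (rule tendsto_mono[OF F(2)])
    have "\<forall>\<^sub>F n in F. AE z in \<gamma>s n. norm (snd z) \<le> R \<longrightarrow> g z = 0"
      using g by (simp add: negligible_functions_def)
    then show "\<forall>\<^sub>F n in F. (\<integral>z. f j z \<partial>\<gamma>s n) \<le> \<epsilon>"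
    proof eventually_elim
      case (elim n)
      interpret prob_space "\<gamma>s n" by (rule prob_space_\<gamma>s)
      have "(\<integral>z. f j z \<partial>\<gamma>s n) \<le> (\<integral>z. indicator {z. R < norm (snd z)} z \<partial>\<gamma>s n)"
      proof (rule integral_mono_AE)
        show "integrable (\<gamma>s n) (f j)"
          using f_bound by (intro integrable_const_bound[of _ 1]) (auto simp: abs_le_iff)
        show "integrable (\<gamma>s n) (indicat_real {z. R < norm (snd z)})"
          by (intro integrable_const_bound[of _ 1]) (auto simp: indicator_def)
        show "AE z in \<gamma>s n. f j z \<le> indicat_real {z. R < norm (snd z)} z"
          using elim by eventually_elim (use f_bound in \<open>auto simp: indicator_def f_def\<close>)
      qed
      also have "\<dots> = measure (\<gamma>s n) {z. R < norm (snd z)}" by (simp add: space_\<gamma>s)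
      also have "\<dots> \<le> \<epsilon>" by (rule tail)
      finally show ?case .
    qed
  qed (rule F(1))
  have "(\<lambda>j. \<integral>z. f j z \<partial>\<gamma>) \<longlonglongrightarrow> (\<integral>z. indicator {z. 0 < g z} z \<partial>\<gamma>)"
  proof (rule integral_dominated_convergence)
    show "integrable \<gamma> (\<lambda>_. 1 :: real)" by simp
    show "AE z in \<gamma>. (\<lambda>j. f j z) \<longlonglongrightarrow> indicat_real {z. 0 < g z} z"
    proof (rule AE_I2)
      fix z
      show "(\<lambda>j. f j z) \<longlonglongrightarrow> indicat_real {z. 0 < g z} z"
      proof (cases "0 < g z")
        case True
        obtain J :: nat where J: "1 / g z \<le> real J" using real_arch_simple by blast
        have "f j z = 1" if "J \<le> j" for j
        proof -
          have "1 / g z \<le> real j" using J that by linarith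
          with True show ?thesis by (simp add: f_def field_simps)
        qed
        then have "\<forall>\<^sub>F j in sequentially. f j z = 1" by (auto simp: eventually_sequentially)
        with True show ?thesis by (auto intro: tendsto_eventually)
      next
        case False
        with nn[of z] have "f j z = 0" for j by (simp add: f_def)
        with False show ?thesis by simp
      qed
    qed
    show "AE z in \<gamma>. norm (f j z) \<le> 1" for j using f_bound by (simp add: abs_le_iff)
  qed auto
  then have "(\<integral>z. indicator {z. 0 < g z} z \<partial>\<gamma>) \<le> \<epsilon>"
    using f_le by (intro LIMSEQ_le_const2) auto
  then show ?thesis by (simp add: space_\<gamma>)
qed

text \<open>The complement is a possibly uncountable union of norm-open positivity sets. Lindelof
  leaves countably many, and the positivity sets of their finite sums increase to the union.\<close>

lemma measure_Compl_limit_support: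
  assumes tail: "\<And>n. measure (\<gamma>s n) {z. R < norm (snd z)} \<le> \<epsilon>"
  shows "measure \<gamma> (- limit_support F \<gamma>s R) \<le> \<epsilon>"
proof -
  interpret \<gamma>: prob_space \<gamma> by (rule prob_space_\<gamma>)
  define \<U> where "\<U> = (\<lambda>g. {z. 0 < g z}) ` negligible_functions F \<gamma>s R"
  have op: "open U" if "U \<in> \<U>" for U
    using that unfolding \<U>_def by (auto simp: negligible_functions_def intro: open_positive_sw)
  obtain \<V> where \<V>: "\<V> \<subseteq> \<U>" "countable \<V>" "\<Union>\<V> = \<Union>\<U>"
    by (rule Lindelof_openin[of \<U> UNIV]) (auto simp: op)
  have eq: "- limit_support F \<gamma>s R = \<Union>\<V>"
    unfolding Compl_limit_support \<V>(3) \<U>_def by auto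
  show ?thesis
  proof (cases "\<V> = {}")
    case True
    then show ?thesis unfolding eq using order_trans[OF measure_nonneg tail] by simp
  next
    case False
    have "\<forall>k. \<exists>g. g \<in> negligible_functions F \<gamma>s R \<and> from_nat_into \<V> k = {z. 0 < g z}"
      using from_nat_into[OF False] \<V>(1) unfolding \<U>_def by blast
    then obtain g where g: "\<And>k. g k \<in> negligible_functions F \<gamma>s R"
        "\<And>k. from_nat_into \<V> k = {z. 0 < g k z}"
      by metis
    define A where "A m = {z. 0 < (\<Sum>k<m. g k z)}" for m :: nat
    have nn: "0 \<le> g k z" for k z using g(1)[of k] unfolding negligible_functions_def by blast
    have A_eq: "A m = (\<Union>k<m. {z. 0 < g k z})" for m
    proof -
      have "0 < (\<Sum>k<m. g k z) \<longleftrightarrow> (\<exists>k<m. 0 < g k z)" for z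
      proof -
        have "0 < (\<Sum>k<m. g k z) \<longleftrightarrow> (\<Sum>k<m. g k z) \<noteq> 0"
          using sum_nonneg[of "{..<m}" "\<lambda>k. g k z"] nn by (auto simp: less_le)
        also have "\<dots> \<longleftrightarrow> (\<exists>k<m. g k z \<noteq> 0)"
          using nn by (subst sum_nonneg_eq_0_iff) auto
        finally show ?thesis using nn[of _ z] by (auto simp: less_le)
      qed
      then show ?thesis unfolding A_def by auto
    qed
    have "\<Union>\<V> = (\<Union>m. A m)"
    proof -
      have "\<Union>\<V> = (\<Union>k. from_nat_into \<V> k)"
        using range_from_nat_into[OF False \<V>(2)] by simp
      also have "\<dots> = (\<Union>m. A m)" unfolding A_eq g(2) by blast
      finally show ?thesis .
    qed
    moreover have "(\<lambda>m. measure \<gamma> (A m)) \<longlonglongrightarrow> measure \<gamma> (\<Union>m. A m)"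
    proof (rule \<gamma>.finite_Lim_measure_incseq)
      have "open (A m)" for m
        unfolding A_eq using g(1) by (intro open_UN ballI open_positive_sw) (simp add: negligible_functions_def)
      then show "range A \<subseteq> sets \<gamma>" by (auto simp: sets_\<gamma>)
      show "incseq A" unfolding A_eq incseq_def by fastforce
    qed
    moreover have "measure \<gamma> (A m) \<le> \<epsilon>" for m
      unfolding A_def by (intro measure_negligible_function[OF negligible_functions_sum tail] g(1))
    ultimately show ?thesis unfolding eq by (auto intro: LIMSEQ_le_const2)
  qed
qed

lemma AE_limit_support:
  assumes tight: "\<And>\<epsilon>. 0 < \<epsilon> \<Longrightarrow> \<exists>R. \<forall>n. measure (\<gamma>s n) {z. R < norm (snd z)} \<le> \<epsilon>"
  shows "AE z in \<gamma>. z \<in> (\<Union>k. limit_support F \<gamma>s (real k))"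
proof -
  interpret \<gamma>: prob_space \<gamma> by (rule prob_space_\<gamma>)
  define B where "B = (\<Inter>k. - limit_support F \<gamma>s (real k))"
  have B: "B \<in> sets \<gamma>"
    unfolding B_def sets_\<gamma> by (intro sets.countable_INT'' borel_open open_Compl_limit_support) auto
  have "measure \<gamma> B \<le> \<epsilon>" if "0 < \<epsilon>" for \<epsilon>
  proof -
    obtain R where R: "\<And>n. measure (\<gamma>s n) {z. R < norm (snd z)} \<le> \<epsilon>" using tight[OF \<open>0 < \<epsilon>\<close>] by blast
    obtain k :: nat where "R \<le> real k" using real_arch_simple by blast
    then have "B \<subseteq> - limit_support F \<gamma>s R"
      using limit_support_mono[of R "real k" F \<gamma>s] unfolding B_def by blast
    then have "measure \<gamma> B \<le> measure \<gamma> (- limit_support F \<gamma>s R)"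
      by (intro \<gamma>.finite_measure_mono) (simp_all add: sets_\<gamma> borel_open[OF open_Compl_limit_support])
    also have "\<dots> \<le> \<epsilon>" by (rule measure_Compl_limit_support[OF R])
    finally show ?thesis .
  qed
  then have "measure \<gamma> B \<le> 0" by (intro field_le_epsilon[of _ 0]) simp
  then have "measure \<gamma> B = 0" by (simp add: order.antisym)
  then have "B \<in> null_sets \<gamma>" using B by (simp add: \<gamma>.emeasure_eq_measure null_setsI)
  then have "AE z in \<gamma>. z \<notin> B" by (rule AE_not_in)
  then show ?thesis by eventually_elim (simp add: B_def)
qed

end

text \<open>In this splitting the weak deviation is tested only against the fixed vector
  \<open>x\<close>, and the strong deviation meets \<open>y'\<close>, which is why a radius
  \<open>R\<close> is indispensable.\<close>

lemma inner_approx: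
  assumes "\<bar>inner x (y' - y)\<bar> \<le> \<delta>" "norm (x' - x) \<le> \<delta>" "norm y' \<le> R"
  shows "\<bar>inner x' y' - inner x (y :: 'a::real_inner)\<bar> \<le> \<delta> * (1 + R)"
proof -
  have "inner x' y' - inner x y = inner x (y' - y) + inner (x' - x) y'"
    by (simp add: inner_diff_left inner_diff_right)
  moreover have "\<bar>inner (x' - x) y'\<bar> \<le> norm (x' - x) * norm y'" by (rule Cauchy_Schwarz_ineq2)
  moreover have "norm (x' - x) * norm y' \<le> \<delta> * R"
    using assms(2,3) by (intro mult_mono) (auto intro: order_trans[OF norm_ge_zero])
  ultimately show ?thesis using assms(1) by (simp add: distrib_left)
qed

lemma cyclic_sum_approx:
  assumes close: "\<And>i. i < N \<Longrightarrow> norm (fst (w i) - fst (z i)) \<le> \<delta>"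
    "\<And>i j. i < N \<Longrightarrow> j < N \<Longrightarrow> \<bar>inner (fst (z j)) (snd (w i) - snd (z i))\<bar> \<le> \<delta>"
    and bound: "\<And>i. i < N \<Longrightarrow> norm (snd (w i)) \<le> R"
  shows "cyclic_sum N z \<le> cyclic_sum N w + 2 * real N * (\<delta> * (1 + R))"
proof -
  have "inner (fst (z (Suc i mod N)) - fst (z i)) (snd (z i)) \<le>
      inner (fst (w (Suc i mod N)) - fst (w i)) (snd (w i)) + 2 * (\<delta> * (1 + R))" if "i < N" for i
  proof -
    have "Suc i mod N < N" using that by simp
    have "\<bar>inner (fst (w j)) (snd (w i)) - inner (fst (z j)) (snd (z i))\<bar> \<le> \<delta> * (1 + R)" if "j < N" for j
      using close bound \<open>i < N\<close> that by (intro inner_approx) auto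
    from this[OF \<open>i < N\<close>] this[OF \<open>Suc i mod N < N\<close>] show ?thesis
      by (simp add: inner_diff_left)
  qed
  then have "cyclic_sum N z \<le> (\<Sum>i<N. inner (fst (w (Suc i mod N)) - fst (w i)) (snd (w i)) + 2 * (\<delta> * (1 + R)))"
    unfolding cyclic_sum_def by (intro sum_mono) auto
  then show ?thesis by (simp add: sum.distrib cyclic_sum_def)
qed

text \<open>A cycle in the limit support is approximated by a cycle of points of a single
  \<open>\<gamma>s n\<close> that satisfies the inequality, with second components of norm at most
  \<open>R\<close>; \<open>cyclic_sum_approx\<close> controls the error.\<close>

lemma cyclically_monotone_limit_support:
  fixes \<gamma>s :: "nat \<Rightarrow> ('a::{real_inner, polish_space} \<times> 'a) measure"
  assumes \<gamma>s: "\<And>n. \<gamma>s n \<in> borel_prob"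
    and cyc: "\<And>n N. AE w in Pi\<^sub>M {..<N} (\<lambda>_. \<gamma>s n). cyclic_sum N w \<le> 0"
    and F: "F \<noteq> bot" "\<And>P. eventually P F \<or> eventually (\<lambda>n. \<not> P n) F"
  shows "cyclically_monotone (\<Union>k. limit_support F \<gamma>s (real k))"
  unfolding cyclically_monotone_def
proof (intro allI impI)
  fix N and z :: "nat \<Rightarrow> 'a \<times> 'a" assume "\<forall>i<N. z i \<in> (\<Union>k. limit_support F \<gamma>s (real k))"
  then obtain k where k: "\<And>i. i < N \<Longrightarrow> z i \<in> limit_support F \<gamma>s (real (k i))"
    by (simp add: Bex_def) metis
  \<comment> \<open>The sum serves as a common upper bound of the radii and needs no case
    distinction for \<open>N = 0\<close>.\<close>
  define R where "R = real (\<Sum>i<N. k i)"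
  have "0 \<le> R" unfolding R_def by (rule of_nat_0_le_iff)
  have z: "z i \<in> limit_support F \<gamma>s R" if "i < N" for i
  proof -
    have "k i \<le> (\<Sum>i<N. k i)" using that by (intro member_le_sum) auto
    then have "real (k i) \<le> R" unfolding R_def by (rule of_nat_mono)
    then show ?thesis using k[OF that] limit_support_mono by blast
  qed
  have main: "cyclic_sum N z \<le> 2 * real N * (\<delta> * (1 + R))" if "0 < \<delta>" for \<delta>
  proof -
    \<comment> \<open>A bump that is positive exactly on a strong-weak neighbourhood of
      \<open>z i\<close>, given by one norm condition and \<open>N\<close> weak conditions.\<close>
    define g where "g i p = max 0 (\<delta> - norm (fst p - fst (z i)) -
        (\<Sum>j<N. \<bar>inner (fst (z j)) (snd p - snd (z i))\<bar>))" for i and p :: "'a \<times> 'a"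
    have g_cont: "continuous_map sw_topology euclideanreal (g i)" for i
    proof -
      have 1: "continuous_map sw_topology euclideanreal (\<lambda>p. norm (fst p - fst (z i)))"
        unfolding sw_topology_def
        by (rule continuous_map_compose[OF continuous_map_fst, unfolded o_def, of euclidean _ "\<lambda>x. norm (x - fst (z i))"])
           (simp add: continuous_intros)
      have 2: "continuous_map sw_topology euclideanreal (\<lambda>p. inner (fst (z j)) (snd p))" for j
        unfolding sw_topology_def
        by (rule continuous_map_compose[OF continuous_map_snd, unfolded o_def])
           (intro continuous_map_weak_topology_linear bounded_linear_inner_right)
      show ?thesis
        unfolding g_def inner_diff_right
        by (intro continuous_map_real_max continuous_map_diff continuous_map_sum
            continuous_map_real_abs 1 2) auto
    qed
    have [measurable]: "g i \<in> borel_measurable borel" for i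
      using continuous_on_if_sw[OF g_cont] by (rule borel_measurable_continuous_onI)
    \<comment> \<open>Here the ultrafilter acts: not eventually null becomes eventually not null,
      and finitely many such events then hold for one \<open>n\<close>.\<close>
    have "\<forall>\<^sub>F n in F. \<not> (AE p in \<gamma>s n. norm (snd p) \<le> R \<longrightarrow> g i p = 0)" if "i < N" for i
    proof -
      have "g i (z i) \<noteq> 0" using \<open>0 < \<delta>\<close> by (simp add: g_def)
      then have "g i \<notin> negligible_functions F \<gamma>s R"
        using z[OF that] by (auto simp: limit_support_def)
      then have "\<not> (\<forall>\<^sub>F n in F. AE p in \<gamma>s n. norm (snd p) \<le> R \<longrightarrow> g i p = 0)"
        using g_cont by (simp add: negligible_functions_def g_def)
      then show ?thesis using F(2) by blast
    qed
    then have "\<forall>\<^sub>F n in F. \<forall>i\<in>{..<N}. \<not> (AE p in \<gamma>s n. norm (snd p) \<le> R \<longrightarrow> g i p = 0)"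
      by (intro eventually_ball_finite) auto
    from eventually_happens'[OF F(1) this] obtain n where
      n: "\<And>i. i < N \<Longrightarrow> \<not> (AE p in \<gamma>s n. norm (snd p) \<le> R \<longrightarrow> g i p = 0)" by auto
    have "prob_space (\<gamma>s n)" and sets_n [measurable_cong]: "sets (\<gamma>s n) = sets borel"
      using \<gamma>s[of n] by (auto simp: borel_prob_def)
    then interpret prob_space "\<gamma>s n" by simp
    interpret product_sigma_finite "\<lambda>_ :: nat. \<gamma>s n" by standard
    define B where "B i = {p. norm (snd p) \<le> R \<and> 0 < g i p}" for i
    have B_sets [measurable]: "B i \<in> sets (\<gamma>s n)" for i unfolding B_def by measurable
    have "emeasure (\<gamma>s n) (B i) \<noteq> 0" if "i < N" for i
    proof
      assume "emeasure (\<gamma>s n) (B i) = 0"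
      then have "AE p in \<gamma>s n. p \<notin> B i" by (intro AE_not_in null_setsI B_sets)
      then have "AE p in \<gamma>s n. norm (snd p) \<le> R \<longrightarrow> g i p = 0"
        by eventually_elim (auto simp: B_def g_def)
      with n[OF that] show False by simp
    qed
    \<comment> \<open>The product of sets of positive mass has positive mass, so it contains a point
      at which the almost sure inequality holds.\<close>
    then have "emeasure (Pi\<^sub>M {..<N} (\<lambda>_. \<gamma>s n)) (Pi\<^sub>E {..<N} B) \<noteq> 0"
      by (subst emeasure_PiM) auto
    moreover have "Pi\<^sub>E {..<N} B \<in> sets (Pi\<^sub>M {..<N} (\<lambda>_. \<gamma>s n))"
      by (intro sets_PiM_I_finite) auto
    ultimately have "\<not> (AE w in Pi\<^sub>M {..<N} (\<lambda>_. \<gamma>s n). w \<notin> Pi\<^sub>E {..<N} B)"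
      using AE_iff_null_sets by (metis null_setsD1)
    then have "\<exists>w\<in>Pi\<^sub>E {..<N} B. cyclic_sum N w \<le> 0"
      using cyc[of N n] by (metis (mono_tags, lifting) eventually_mono)
    then obtain w where w: "\<And>i. i < N \<Longrightarrow> w i \<in> B i" and w0: "cyclic_sum N w \<le> 0" by auto
    have close: "norm (fst (w i) - fst (z i)) \<le> \<delta>"
      "j < N \<Longrightarrow> \<bar>inner (fst (z j)) (snd (w i) - snd (z i))\<bar> \<le> \<delta>" if "i < N" for i j
    proof -
      let ?s = "\<Sum>j<N. \<bar>inner (fst (z j)) (snd (w i) - snd (z i))\<bar>"
      have *: "norm (fst (w i) - fst (z i)) + ?s < \<delta>"
        using w[OF that] by (auto simp: B_def g_def)
      have "0 \<le> ?s" by (intro sum_nonneg) auto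
      with * show "norm (fst (w i) - fst (z i)) \<le> \<delta>" by linarith
      assume "j < N"
      then have "\<bar>inner (fst (z j)) (snd (w i) - snd (z i))\<bar> \<le> ?s"
        by (intro member_le_sum) auto
      with * show "\<bar>inner (fst (z j)) (snd (w i) - snd (z i))\<bar> \<le> \<delta>"
        using norm_ge_zero[of "fst (w i) - fst (z i)"] by linarith
    qed
    have "cyclic_sum N z \<le> cyclic_sum N w + 2 * real N * (\<delta> * (1 + R))"
      using w close by (intro cyclic_sum_approx) (auto simp: B_def)
    with w0 show ?thesis by linarith
  qed
  show "cyclic_sum N z \<le> 0"
  proof (rule field_le_epsilon)
    fix e :: real assume "0 < e"
    \<comment> \<open>Dividing by \<open>C + 1\<close> rather than \<open>C\<close> also covers
      \<open>N = 0\<close>, where \<open>C\<close> vanishes.\<close>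
    define C where "C = 2 * real N * (1 + R)"
    have "0 \<le> C" using \<open>0 \<le> R\<close> by (simp add: C_def)
    have "cyclic_sum N z \<le> 2 * real N * (e / (C + 1) * (1 + R))"
      using \<open>0 < e\<close> \<open>0 \<le> C\<close> by (intro main) auto
    also have "\<dots> = e * (C / (C + 1))" by (simp add: C_def)
    also have "\<dots> \<le> e * 1" using \<open>0 < e\<close> \<open>0 \<le> C\<close> by (intro mult_left_mono) auto
    finally show "cyclic_sum N z \<le> 0 + e" by simp
  qed
qed

text \<open>Tightness is asked for in terms of balls because both halves of the theorem can supply
  this form: weakly compact sets are bounded, and the gliding hump yields a tail estimate but no
  compact set.\<close>

lemma optimal_couplings_stable:
  fixes \<mu>1 \<mu>2 :: "'a::{real_inner, polish_space} measure"
  assumes P2s: "\<And>n. \<mu>1s n \<in> P2" "\<And>n. \<mu>2s n \<in> P2"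
    and opt: "\<And>n. \<gamma>s n \<in> optimal_couplings (\<mu>1s n) (\<mu>2s n)"
    and P2: "\<mu>1 \<in> P2" "\<mu>2 \<in> P2" and cpl: "\<gamma> \<in> couplings \<mu>1 \<mu>2"
    and narrow: "narrowly_converges sw_topology \<gamma>s \<gamma>"
    and tight: "\<And>\<epsilon>. 0 < \<epsilon> \<Longrightarrow> \<exists>R. \<forall>n. measure (\<gamma>s n) {z. R < norm (snd z)} \<le> \<epsilon>"
  shows "\<gamma> \<in> optimal_couplings \<mu>1 \<mu>2"
proof -
  obtain F :: "nat filter" where ultra: "F \<noteq> bot" "F \<le> sequentially"
      "\<And>P. eventually P F \<or> eventually (\<lambda>n. \<not> P n) F"
    by (rule ultrafilter_on_sequence) (rule that)
  have \<gamma>s: "\<gamma>s n \<in> borel_prob" for n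
    using opt[of n] by (simp add: optimal_couplings_def couplings_def)
  interpret narrow_limit \<gamma>s \<gamma> F
    using \<gamma>s cpl narrow ultra by unfold_locales (auto simp: couplings_def)
  show ?thesis
  proof (rule cyclically_monotone_imp_optimal[OF cpl P2])
    show "cyclically_monotone (\<Union>k. limit_support F \<gamma>s (real k))"
      using \<gamma>s optimal_coupling_cyclic_sum_nonpos[OF opt P2s] ultra(1,3)
      by (rule cyclically_monotone_limit_support)
    show "AE z in \<gamma>. z \<in> (\<Union>k. limit_support F \<gamma>s (real k))"
      by (rule AE_limit_support[OF tight])
  qed
qed

section \<open>Convergence against test functions of quadratic growth\<close>

lemma narrowly_converges_distr:
  assumes narrow: "narrowly_converges X \<gamma>s \<gamma>" and h: "continuous_map X Y h"
    and meas: "\<And>f :: 'b \<Rightarrow> real. continuous_map Y euclideanreal f \<Longrightarrow> f \<in> borel_measurable N"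
    and "h \<in> \<gamma> \<rightarrow>\<^sub>M N" "\<And>n. h \<in> \<gamma>s n \<rightarrow>\<^sub>M N"
  shows "narrowly_converges Y (\<lambda>n. distr (\<gamma>s n) N h) (distr \<gamma> N h)"
  unfolding narrowly_converges_def
proof (intro allI impI, elim conjE)
  fix f :: "'b \<Rightarrow> real" assume f: "continuous_map Y euclideanreal f" "bounded (f ` topspace Y)"
  have "continuous_map X euclideanreal (\<lambda>z. f (h z))"
    using continuous_map_compose[OF h f(1)] by (simp add: o_def)
  moreover have "bounded ((\<lambda>z. f (h z)) ` topspace X)"
    using continuous_map_image_subset_topspace[OF h] by (intro bounded_subset[OF f(2)]) auto
  ultimately have "(\<lambda>n. \<integral>z. f (h z) \<partial>\<gamma>s n) \<longlonglongrightarrow> (\<integral>z. f (h z) \<partial>\<gamma>)"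
    using narrow unfolding narrowly_converges_def by blast
  then show "(\<lambda>n. \<integral>x. f x \<partial>distr (\<gamma>s n) N h) \<longlonglongrightarrow> (\<integral>x. f x \<partial>distr \<gamma> N h)"
    using assms(4,5) meas[OF f(1)] by (simp add: integral_distr)
qed

lemma coupling_tail_le:
  fixes \<mu>1 \<mu>2 :: "'a::{real_inner, polish_space} measure"
  assumes "\<gamma> \<in> couplings \<mu>1 \<mu>2" "compactin weak_topology K" "K \<subseteq> cball 0 R"
  shows "measure \<gamma> {z. R < norm (snd z)} \<le> measure \<mu>2 (topspace weak_topology - K)"
proof -
  note [measurable_cong] = couplingsD(2)[OF assms(1)]
  interpret prob_space \<gamma> by (rule couplingsD(1)[OF assms(1)])
  note snd_meas = coupling_measurable(2)[OF assms(1)]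
  have K: "UNIV - K \<in> sets borel" using weakly_compact_closed[OF assms(2)] by simp
  have "measure \<gamma> {z. R < norm (snd z)} \<le> measure \<gamma> (snd -` (UNIV - K) \<inter> space \<gamma>)"
    using assms(3) measurable_sets[OF snd_meas K]
    by (intro finite_measure_mono) (auto simp: couplingsD(3)[OF assms(1)])
  also have "\<dots> = measure (distr \<gamma> borel snd) (UNIV - K)"
    by (rule measure_distr[OF snd_meas K, symmetric])
  finally show ?thesis by (simp add: couplingsD(5)[OF assms(1)])
qed

section \<open>What convergence in \<open>P22_sw\<close> provides\<close>

lemma P22_sw_limit_in_P22:
  assumes "limitin P22_sw \<gamma>s \<gamma> F"
  shows "\<gamma> \<in> P22"
proof -
  have "\<gamma> \<in> topspace P22_sw" using assms by (simp add: limitin_def)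
  then show ?thesis unfolding P22_sw_def topology_generated_by_topspace by auto
qed

lemma P22_sw_limit_integral:
  assumes lim: "limitin P22_sw \<gamma>s \<gamma> F" and \<zeta>: "\<zeta> \<in> sw_test_functions"
  shows "((\<lambda>n. \<integral>z. \<zeta> z \<partial>\<gamma>s n) \<longlongrightarrow> (\<integral>z. \<zeta> z \<partial>\<gamma>)) F"
proof (rule topological_tendstoI)
  fix U :: "real set" assume U: "open U" "(\<integral>z. \<zeta> z \<partial>\<gamma>) \<in> U"
  let ?V = "{\<mu> \<in> P22. (\<integral>z. \<zeta> z \<partial>\<mu>) \<in> U}"
  have "openin P22_sw ?V"
    unfolding P22_sw_def using \<zeta> U(1) by (intro topology_generated_by_Basis) blast
  then have "\<forall>\<^sub>F n in F. \<gamma>s n \<in> ?V"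
    using lim U(2) P22_sw_limit_in_P22[OF lim] by (auto simp: limitin_def)
  then show "\<forall>\<^sub>F n in F. (\<integral>z. \<zeta> z \<partial>\<gamma>s n) \<in> U" by eventually_elim simp
qed

text \<open>A bound of the function serves as the constant for every \<epsilon>, so
  \<open>P22_sw\<close> convergence implies narrow convergence.\<close>

lemma bounded_continuous_test_function:
  assumes "continuous_map sw_topology euclideanreal f" "bounded (range f)"
  shows "f \<in> sw_test_functions"
proof -
  obtain B where "B > 0" and B: "\<And>z. \<bar>f z\<bar> \<le> B"
    using assms(2) by (auto simp: bounded_pos)
  have "\<bar>f (x, y)\<bar> \<le> B * (1 + (norm x)\<^sup>2) + \<epsilon> * (norm y)\<^sup>2" if "0 < \<epsilon>" for x y \<epsilon>
  proof -
    have "\<bar>f (x, y)\<bar> \<le> B" by (rule B)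
    also have "\<dots> \<le> B * (1 + (norm x)\<^sup>2)" using \<open>B > 0\<close> by simp
    also have "\<dots> \<le> B * (1 + (norm x)\<^sup>2) + \<epsilon> * (norm y)\<^sup>2" using that by simp
    finally show ?thesis .
  qed
  moreover have "seq_continuous sw_topology f"
    unfolding seq_continuous_def using continuous_map_limit[OF assms(1)] by (auto simp: o_def)
  ultimately show ?thesis
    unfolding sw_test_functions_def using \<open>B > 0\<close> by (auto intro!: exI[of _ B])
qed

lemma P22_sw_limit_narrow:
  assumes "limitin P22_sw \<gamma>s \<gamma> sequentially"
  shows "narrowly_converges sw_topology \<gamma>s \<gamma>"
  unfolding narrowly_converges_def
  using P22_sw_limit_integral[OF assms] bounded_continuous_test_function by auto

text \<open>With unit vectors these are weakly continuous lower approximations of the norm, which in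
  infinite dimensions is only weakly lower semicontinuous and so cannot be used to build the
  bumps.\<close>

fun running_max :: "(nat \<Rightarrow> 'a::real_inner) \<Rightarrow> nat \<Rightarrow> 'a \<Rightarrow> real" where
  "running_max u 0 y = 0"
| "running_max u (Suc m) y = max (running_max u m y) (inner (u m) y)"

lemma running_max_weak_continuous:
  "continuous_map weak_topology euclideanreal (running_max u m)"
proof (induction m)
  case 0
  have "running_max u 0 = (\<lambda>_. 0)" by auto
  then show ?case by simp
next
  case (Suc m)
  have "running_max u (Suc m) = (\<lambda>y. max (running_max u m y) (inner (u m) y))" by auto
  then show ?case
    using Suc continuous_map_weak_topology_linear[OF bounded_linear_inner_right]
    by (auto intro!: continuous_map_real_max)
qed

lemma running_max_le:
  assumes "\<And>j. norm (u j) \<le> 1"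
  shows "running_max u m y \<le> norm y"
proof (induction m)
  case (Suc m)
  have "inner (u m) y \<le> norm (u m) * norm y" by (rule norm_cauchy_schwarz)
  also have "\<dots> \<le> norm y" using assms by (simp add: mult_left_le_one_le)
  finally show ?case using Suc by simp
qed simp

lemma running_max_mono: "m \<le> m' \<Longrightarrow> running_max u m y \<le> running_max u m' y"
  by (rule lift_Suc_mono_le[of "\<lambda>m. running_max u m y"]) auto

lemma running_max_exhausts:
  obtains u :: "nat \<Rightarrow> 'a::{real_inner, second_countable_topology}"
  where "\<And>j. norm (u j) \<le> 1" "\<And>t y. 0 \<le> t \<Longrightarrow> t < norm y \<Longrightarrow> \<exists>m. t < running_max u m y"
proof -
  obtain D :: "'a set" where D: "countable D" "\<And>X. open X \<Longrightarrow> X \<noteq> {} \<Longrightarrow> \<exists>d\<in>D. d \<in> X"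
    by (rule countable_dense_setE) blast
  have "D \<noteq> {}" using D(2)[of UNIV] by auto
  define u where "u j = sgn (from_nat_into D j)" for j
  show thesis
  proof
    show "norm (u j) \<le> 1" for j by (simp add: u_def norm_sgn)
    fix t :: real and y :: 'a assume t: "0 \<le> t" "t < norm y"
    \<comment> \<open>The condition is invariant under positive scaling and holds at
      \<open>y\<close> itself, so a dense sequence satisfies it somewhere and may be normalised
      afterwards.\<close>
    have "open {v. t * norm v < inner v y}" by (intro open_Collect_less continuous_intros)
    moreover have "t * norm y < inner y y"
      unfolding dot_square_norm power2_eq_square using t by (intro mult_strict_right_mono) auto
    ultimately obtain d where d: "d \<in> D" "t * norm d < inner d y" using D(2) by blast
    obtain j where j: "from_nat_into D j = d" using from_nat_into_surj[OF D(1) d(1)] by blast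
    have "d \<noteq> 0" using d by auto
    then have "t < inner (u j) y"
      using d(2) by (simp add: u_def j sgn_div_norm field_simps)
    then show "\<exists>m. t < running_max u m y" by (intro exI[of _ "Suc j"]) (simp add: less_max_iff_disj)
  qed
qed

lemma real_of_nat_le_square: "real k \<le> (real k)\<^sup>2"
  by (cases k) (simp_all add: power2_eq_square)

text \<open>
  Gliding hump: a test function which is a sum of bumps \<open>b k\<close> of height \<open>k\<close>, supported far away, so
  that it grows slower than quadratically but has large integral against a sequence of measures
  with mass escaping to infinity.
\<close>

locale gliding_hump =
  fixes b :: "nat \<Rightarrow> 'a::{real_inner, polish_space} \<Rightarrow> real"
  assumes cont: "\<And>k. continuous_map weak_topology euclideanreal (b k)"
    and range: "\<And>k y. 0 \<le> b k y" "\<And>k y. b k y \<le> real k"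
    and zero: "\<And>k y. norm y \<le> (real k)\<^sup>2 \<Longrightarrow> b k y = 0"
begin

definition hump where "hump y = (\<Sum>k. b k y)"

lemma hump_eq_sum:
  assumes "norm y \<le> (real K)\<^sup>2"
  shows "hump y = (\<Sum>k<K. b k y)"
  unfolding hump_def
proof (rule suminf_finite)
  fix k assume "k \<notin> {..<K}"
  then have "(real K)\<^sup>2 \<le> (real k)\<^sup>2" by (intro power_mono) auto
  with assms show "b k y = 0" by (intro zero) (rule order_trans)
qed simp

lemma bump_le_hump: "b k y \<le> hump y"
proof -
  obtain K :: nat where K: "norm y + real k + 1 \<le> real K" using real_arch_simple by blast
  then have "norm y \<le> (real K)\<^sup>2" using real_of_nat_le_square[of K] by linarith
  moreover have "k < K" using K norm_ge_zero[of y] by linarith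
  ultimately show ?thesis
    using range(1) by (auto simp: hump_eq_sum intro!: member_le_sum)
qed

lemma hump_nonneg: "0 \<le> hump y"
  using range(1) bump_le_hump by (rule order_trans)

text \<open>The balance of height \<open>k\<close> against radius \<open>k\<close> squared: about
  sqrt(|y|) bumps are active at \<open>y\<close>, each of height at most about sqrt(|y|), so the
  growth is linear.\<close>

lemma hump_le: "hump y \<le> 2 * norm y + 2"
proof -
  define K where "K = nat \<lceil>sqrt (norm y)\<rceil>"
  have K: "sqrt (norm y) \<le> real K" "real K \<le> sqrt (norm y) + 1"
    using real_sqrt_ge_zero[OF norm_ge_zero[of y]] unfolding K_def by linarith+
  have "hump y = (\<Sum>k<K. b k y)"
  proof (rule hump_eq_sum)
    have "(sqrt (norm y))\<^sup>2 \<le> (real K)\<^sup>2" using K(1) by (intro power_mono) auto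
    then show "norm y \<le> (real K)\<^sup>2" by simp
  qed
  also have "\<dots> \<le> (\<Sum>k<K. real K)"
    by (intro sum_mono order_trans[OF range(2)]) auto
  also have "\<dots> = (real K)\<^sup>2" by (simp add: power2_eq_square)
  also have "\<dots> \<le> (sqrt (norm y) + 1)\<^sup>2" using K(2) by (intro power_mono) auto
  also have "\<dots> \<le> 2 * norm y + 2"
    using sum_squares_bound[of "sqrt (norm y)" 1] by (simp add: power2_sum)
  finally show ?thesis .
qed

text \<open>A weakly convergent sequence lies in a ball, where the sum is finite with a fixed number
  of terms. Linear growth is absorbed into \<epsilon>|y|^2 by completing a square.\<close>

lemma hump_test_function: "(\<lambda>z. hump (snd z)) \<in> sw_test_functions"
proof -
  have "(\<lambda>n. hump (snd (zs n))) \<longlonglongrightarrow> hump (snd z)"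
    if "limitin sw_topology zs z sequentially" for zs z
  proof -
    have lim: "limitin weak_topology (\<lambda>n. snd (zs n)) (snd z) sequentially"
      using that unfolding sw_topology_def limitin_pairwise by (simp add: o_def)
    obtain B where B: "\<And>n. norm (snd (zs n)) \<le> B"
      using weakly_convergent_bounded[OF lim] by (auto simp: bounded_iff)
    obtain K :: nat where K: "norm (snd z) + \<bar>B\<bar> + 1 \<le> real K" using real_arch_simple by blast
    then have "norm (snd z) \<le> (real K)\<^sup>2" "norm (snd (zs n)) \<le> (real K)\<^sup>2" for n
      using real_of_nat_le_square[of K] B[of n] norm_ge_zero[of "snd z"] by linarith+
    then have "hump (snd z) = (\<Sum>k<K. b k (snd z))" "\<And>n. hump (snd (zs n)) = (\<Sum>k<K. b k (snd (zs n)))"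
      by (simp_all add: hump_eq_sum)
    then show ?thesis
      using continuous_map_limit[OF cont lim] by (auto simp: o_def intro!: tendsto_sum)
  qed
  moreover have "\<bar>hump y\<bar> \<le> (2 + 1 / \<epsilon>) * (1 + (norm x)\<^sup>2) + \<epsilon> * (norm y)\<^sup>2" if "0 < \<epsilon>" for x y :: 'a and \<epsilon>
  proof -
    have "2 * norm y \<le> 1 / \<epsilon> + \<epsilon> * (norm y)\<^sup>2"
    proof -
      have "0 \<le> (\<epsilon> * norm y - 1)\<^sup>2 / \<epsilon>" using that by simp
      also have "\<dots> = \<epsilon> * (norm y)\<^sup>2 - 2 * norm y + 1 / \<epsilon>"
        using that by (simp add: power2_eq_square field_simps)
      finally show ?thesis by simp
    qed
    moreover have "0 \<le> (2 + 1 / \<epsilon>) * (norm x)\<^sup>2" using that by simp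
    ultimately show ?thesis
      using hump_le[of y] hump_nonneg[of y] by (simp add: distrib_left)
  qed
  moreover from this have "\<exists>A\<ge>0. \<forall>(x :: 'a) y. \<bar>hump y\<bar> \<le> A * (1 + (norm x)\<^sup>2) + \<epsilon> * (norm y)\<^sup>2" if "0 < \<epsilon>" for \<epsilon>
    using that by (intro exI[of _ "2 + 1 / \<epsilon>"]) simp
  ultimately show ?thesis
    unfolding sw_test_functions_def seq_continuous_def mem_Collect_eq snd_conv by blast
qed

lemma bump_measurable [measurable]: "b k \<in> borel_measurable borel"
  by (rule borel_measurable_continuous_onI[OF continuous_on_if_weak[OF cont]])

lemma hump_measurable [measurable]: "hump \<in> borel_measurable borel"
  unfolding hump_def by measurable

lemma integrable_hump:
  assumes "\<mu> \<in> P22"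
  shows "integrable \<mu> (\<lambda>z. hump (snd z))"
proof (rule Bochner_Integration.integrable_bound)
  have [measurable_cong]: "sets \<mu> = sets borel" and "prob_space \<mu>"
    and int: "integrable \<mu> (\<lambda>z. (norm (fst z))\<^sup>2 + (norm (snd z))\<^sup>2)"
    using assms unfolding P22_def borel_prob_def case_prod_beta by simp_all
  then interpret prob_space \<mu> by simp
  show "integrable \<mu> (\<lambda>z. 3 + ((norm (fst z))\<^sup>2 + (norm (snd z))\<^sup>2))"
    using int by simp
  show "(\<lambda>z. hump (snd z)) \<in> borel_measurable \<mu>" by measurable
  show "AE z in \<mu>. norm (hump (snd z)) \<le> norm (3 + ((norm (fst z))\<^sup>2 + (norm (snd z))\<^sup>2))"
  proof (rule AE_I2)
    fix z :: "'a \<times> 'a"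
    have "2 * norm (snd z) \<le> 1 + (norm (snd z))\<^sup>2"
      using sum_squares_bound[of "norm (snd z)" 1] by simp
    then show "norm (hump (snd z)) \<le> norm (3 + ((norm (fst z))\<^sup>2 + (norm (snd z))\<^sup>2))"
      using hump_le[of "snd z"] hump_nonneg[of "snd z"] zero_le_power2[of "norm (fst z)"]
      unfolding real_norm_def by linarith
  qed
qed

end

text \<open>If mass above \<epsilon> kept appearing beyond every radius, bump \<open>k\<close> alone
  would make the hump integral at least \<open>k * \<epsilon>\<close> for some index, against the
  convergence of these integrals.\<close>

lemma P22_sw_limit_tight:
  fixes \<gamma>s :: "nat \<Rightarrow> ('a::{real_inner, polish_space} \<times> 'a) measure"
  assumes lim: "limitin P22_sw \<gamma>s \<gamma> sequentially" and P22: "\<And>n. \<gamma>s n \<in> P22" and "0 < \<epsilon>"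
  shows "\<exists>R. \<forall>n. measure (\<gamma>s n) {z. R < norm (snd z)} \<le> \<epsilon>"
proof (rule ccontr)
  assume "\<not> ?thesis"
  \<comment> \<open>The \<open>+ 1\<close> leaves the unit of room in which bump \<open>k\<close>
    climbs from 0 to its full height.\<close>
  then have "\<forall>k. \<exists>n. \<epsilon> < measure (\<gamma>s n) {z. (real k)\<^sup>2 + 1 < norm (snd z)}"
    by (meson not_le)
  then obtain n where n: "\<And>k. \<epsilon> < measure (\<gamma>s (n k)) {z. (real k)\<^sup>2 + 1 < norm (snd z)}" by metis
  obtain u :: "nat \<Rightarrow> 'a" where u: "\<And>j. norm (u j) \<le> 1"
      "\<And>t y. 0 \<le> t \<Longrightarrow> t < norm y \<Longrightarrow> \<exists>m. t < running_max u m y"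
    by (rule running_max_exhausts) blast
  have sets [measurable_cong]: "sets (\<gamma>s i) = sets borel" and prob: "prob_space (\<gamma>s i)" for i
    using P22[of i] by (auto simp: P22_def borel_prob_def)
  have [measurable]: "running_max u m \<in> borel_measurable borel" for m
    by (rule borel_measurable_continuous_onI[OF continuous_on_if_weak[OF running_max_weak_continuous]])
  have "\<exists>m. \<epsilon> < measure (\<gamma>s (n k)) {z. (real k)\<^sup>2 + 1 < running_max u m (snd z)}" for k
  proof -
    interpret prob_space "\<gamma>s (n k)" by (rule prob)
    let ?A = "\<lambda>m. {z :: 'a \<times> 'a. (real k)\<^sup>2 + 1 < running_max u m (snd z)}"
    have "(\<Union>m. ?A m) = {z. (real k)\<^sup>2 + 1 < norm (snd z)}"
      using u(2)[of "(real k)\<^sup>2 + 1"] running_max_le[of u, OF u(1)] by (fastforce intro: less_le_trans)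
    moreover have "(\<lambda>m. measure (\<gamma>s (n k)) (?A m)) \<longlonglongrightarrow> measure (\<gamma>s (n k)) (\<Union>m. ?A m)"
      by (rule finite_Lim_measure_incseq)
         (auto simp: incseq_def intro: less_le_trans running_max_mono)
    ultimately have "\<forall>\<^sub>F m in sequentially. \<epsilon> < measure (\<gamma>s (n k)) (?A m)"
      using n[of k] by (intro order_tendstoD(1)) auto
    then show ?thesis by (auto simp: eventually_sequentially)
  qed
  then obtain m where m: "\<And>k. \<epsilon> < measure (\<gamma>s (n k)) {z. (real k)\<^sup>2 + 1 < running_max u (m k) (snd z)}"
    by metis
  define b where "b k y = real k * min 1 (max 0 (running_max u (m k) y - (real k)\<^sup>2))" for k y
  interpret gliding_hump b
  proof
    show "continuous_map weak_topology euclideanreal (b k)" for k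
      unfolding b_def
      by (intro continuous_map_real_mult continuous_map_real_min continuous_map_real_max
          continuous_map_diff running_max_weak_continuous) auto
    show "0 \<le> b k y" "b k y \<le> real k" for k y
      by (auto simp: b_def intro!: mult_left_le)
    show "b k y = 0" if "norm y \<le> (real k)\<^sup>2" for k y
      using running_max_le[of u "m k" y, OF u(1)] that by (simp add: b_def)
  qed
  \<comment> \<open>The indices \<open>n k\<close> may repeat and need not tend to infinity, so the
    bound is taken over the whole sequence.\<close>
  have "Bseq (\<lambda>i. \<integral>z. hump (snd z) \<partial>\<gamma>s i)"
    using P22_sw_limit_integral[OF lim hump_test_function] by (intro convergent_imp_Bseq) (auto simp: convergent_def)
  then obtain B where B: "\<And>i. (\<integral>z. hump (snd z) \<partial>\<gamma>s i) \<le> B"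
    by (auto simp: Bseq_def abs_le_iff)
  have "real k * \<epsilon> \<le> B" for k
  proof -
    interpret prob_space "\<gamma>s (n k)" by (rule prob)
    let ?A = "{z :: 'a \<times> 'a. (real k)\<^sup>2 + 1 < running_max u (m k) (snd z)}"
    have "?A \<in> sets (\<gamma>s (n k))" by measurable
    have sp: "space (\<gamma>s i) = UNIV" for i using sets_eq_imp_space_eq[OF sets[of i]] by simp
    have "real k * \<epsilon> \<le> real k * measure (\<gamma>s (n k)) ?A"
      using m[of k] by (intro mult_left_mono) auto
    also have "\<dots> = (\<integral>z. real k * indicator ?A z \<partial>\<gamma>s (n k))" by (simp add: sp)
    also have "\<dots> \<le> (\<integral>z. hump (snd z) \<partial>\<gamma>s (n k))"
    proof (rule integral_mono[OF _ integrable_hump[OF P22]])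
      show "integrable (\<gamma>s (n k)) (\<lambda>z. real k * indicat_real ?A z)"
        using \<open>?A \<in> _\<close> by (intro integrable_mult_right) (simp add: integrable_indicator_iff emeasure_eq_measure)
      fix z
      have "real k * indicat_real ?A z \<le> b k (snd z)" by (simp add: b_def indicator_def)
      then show "real k * indicat_real ?A z \<le> hump (snd z)" using bump_le_hump by (rule order_trans)
    qed
    also have "\<dots> \<le> B" by (rule B)
    finally show ?thesis .
  qed
  moreover obtain k :: nat where "B / \<epsilon> < real k" using reals_Archimedean2 by blast
  ultimately show False using \<open>0 < \<epsilon>\<close> by (metis not_le pos_divide_less_eq)
qed

theorem theorem3p8:
  fixes \<mu>1s \<mu>2s :: "nat \<Rightarrow> 'a::{real_inner, polish_space} measure"
    and \<gamma>s :: "nat \<Rightarrow> ('a \<times> 'a) measure"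
  assumes "\<And>n. \<mu>1s n \<in> P2" and "\<And>n. \<mu>2s n \<in> P2"
    and "\<And>n. \<gamma>s n \<in> optimal_couplings (\<mu>1s n) (\<mu>2s n)"
  shows "(\<forall>\<mu>1 \<in> P2. \<forall>\<mu>2 \<in> P2. \<forall>\<gamma> \<in> couplings \<mu>1 \<mu>2.
            tight_in weak_topology (range \<mu>2s) \<and> narrowly_converges sw_topology \<gamma>s \<gamma> \<longrightarrow>
              narrowly_converges euclidean \<mu>1s \<mu>1 \<and>
              narrowly_converges weak_topology \<mu>2s \<mu>2 \<and>
              \<gamma> \<in> optimal_couplings \<mu>1 \<mu>2)
       \<and> (\<forall>r \<gamma>. strict_mono r \<and> limitin P22_sw (\<gamma>s \<circ> r) \<gamma> sequentially \<longrightarrow>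
              \<gamma> \<in> optimal_couplings (distr \<gamma> borel fst) (distr \<gamma> borel snd))"
proof (intro conjI ballI allI impI)
  have cpls: "\<gamma>s n \<in> couplings (\<mu>1s n) (\<mu>2s n)" for n
    using assms(3) by (simp add: optimal_couplings_def)
  {
    fix \<mu>1 \<mu>2 \<gamma>
    assume P2: "\<mu>1 \<in> P2" "\<mu>2 \<in> P2" and cpl: "\<gamma> \<in> couplings \<mu>1 \<mu>2"
      and "tight_in weak_topology (range \<mu>2s) \<and> narrowly_converges sw_topology \<gamma>s \<gamma>"
    then have tight: "tight_in weak_topology (range \<mu>2s)"
      and narrow: "narrowly_converges sw_topology \<gamma>s \<gamma>" by auto
    have "narrowly_converges euclidean (\<lambda>n. distr (\<gamma>s n) borel fst) (distr \<gamma> borel fst)"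
      using coupling_measurable[OF cpl] coupling_measurable[OF cpls] narrow
      by (intro narrowly_converges_distr[where X = sw_topology])
         (auto simp: sw_topology_def continuous_map_fst intro: borel_measurable_continuous_onI)
    then show "narrowly_converges euclidean \<mu>1s \<mu>1"
      by (simp add: couplingsD(4)[OF cpl] couplingsD(4)[OF cpls])
    have "narrowly_converges weak_topology (\<lambda>n. distr (\<gamma>s n) borel snd) (distr \<gamma> borel snd)"
      using coupling_measurable[OF cpl] coupling_measurable[OF cpls] narrow
      by (intro narrowly_converges_distr[where X = sw_topology])
         (auto simp: sw_topology_def continuous_map_snd
           intro: borel_measurable_continuous_onI continuous_on_if_weak)
    then show "narrowly_converges weak_topology \<mu>2s \<mu>2"
      by (simp add: couplingsD(5)[OF cpl] couplingsD(5)[OF cpls])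
    show "\<gamma> \<in> optimal_couplings \<mu>1 \<mu>2"
    proof (rule optimal_couplings_stable[OF assms P2 cpl narrow])
      fix \<epsilon> :: real assume "0 < \<epsilon>"
      then obtain K where K: "compactin weak_topology K"
          "\<And>n. measure (\<mu>2s n) (topspace weak_topology - K) < \<epsilon>"
        using tight by (auto simp: tight_in_def)
      obtain R where R: "K \<subseteq> cball 0 R"
        using weakly_compact_bounded[OF K(1)] unfolding bounded_iff subset_eq mem_cball_0 by blast
      have "measure (\<gamma>s n) {z. R < norm (snd z)} \<le> \<epsilon>" for n
        using coupling_tail_le[OF cpls K(1) R, of n] K(2)[of n] by linarith
      then show "\<exists>R. \<forall>n. measure (\<gamma>s n) {z. R < norm (snd z)} \<le> \<epsilon>" by blast
    qed
  }
  fix r \<gamma>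
  assume "strict_mono r \<and> limitin P22_sw (\<gamma>s \<circ> r) \<gamma> sequentially"
  then have lim: "limitin P22_sw (\<lambda>n. \<gamma>s (r n)) \<gamma> sequentially" by (simp add: o_def)
  have "\<gamma> \<in> P22" by (rule P22_sw_limit_in_P22[OF lim])
  show "\<gamma> \<in> optimal_couplings (distr \<gamma> borel fst) (distr \<gamma> borel snd)"
  \<comment> \<open>The subsequence takes the role of the sequence, and the marginals of the limit
    have finite second moments because the limit lies in \<open>P22\<close>.\<close>
  proof (rule optimal_couplings_stable[where \<gamma>s = "\<lambda>n. \<gamma>s (r n)" and
        \<mu>1s = "\<lambda>n. \<mu>1s (r n)" and \<mu>2s = "\<lambda>n. \<mu>2s (r n)"])
    show "distr \<gamma> borel fst \<in> P2" "distr \<gamma> borel snd \<in> P2"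
      "\<gamma> \<in> couplings (distr \<gamma> borel fst) (distr \<gamma> borel snd)"
      using P22_marginals[OF \<open>\<gamma> \<in> P22\<close>] by auto
    show "narrowly_converges sw_topology (\<lambda>n. \<gamma>s (r n)) \<gamma>"
      by (rule P22_sw_limit_narrow[OF lim])
    show "\<exists>R. \<forall>n. measure (\<gamma>s (r n)) {z. R < norm (snd z)} \<le> \<epsilon>" if "0 < \<epsilon>" for \<epsilon>
      by (rule P22_sw_limit_tight[OF lim _ that]) (rule coupling_in_P22[OF cpls assms(1,2)])
  qed (rule assms)+
qed

end
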